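(* Let $A=(a_{ij})$ be an $n\times n$ matrix which is a conic combination of cut matrices in CDW normal form, and let $B=(b_{ij})$ be an $n\times n$ matrix which is a conic combination of a monotone anti-Monge matrix and a down-benevolent Toeplitz matrix. Then the identity permutation is an optimal solution of $QAP(A,B)$, i.e. for every permutation $\pi$ of $\{1,\ldots,n\}$, $$\sum_{i=1}^n\sum_{j=1}^n a_{ij}\,b_{ij}\;\le\;\sum_{i=1}^n\sum_{j=1}^n a_{\pi(i)\pi(j)}\,b_{ij}.$$
   Context: $QAP(A,B)$: for real $n\times n$ matrices $A=(a_{ij})$, $B=(b_{ij})$, minimize $Z_\pi(A,B)=\sum_{i,j=1}^n a_{\pi(i)\pi(j)}b_{ij}$ over all permutations $\pi$ of $\{1,\ldots,n\}$. A conic combination is a linear combination with non-negative coefficients. A cut matrix is an $n\times n$ $0$-$1$ matrix for which there is a partition of $\{1,\ldots,n\}$ into (possibly empty) sets $I_1,\ldots,I_q$ (blocks), with all elements of $I_k$ smaller than all elements of $I_{k+1}$ for $1\le k\le q-1$, such that the $(i,j)$ entry is $0$ if $i,j$ lie in the same block and $1$ otherwise. It is in CDW normal form if $|I_1|\le|I_2|\le\cdots\le|I_q|$. A matrix $B$ is monotone if $b_{ij}\le b_{i,j+1}$ and $b_{ij}\le b_{i+1,j}$ for all $i,j$. It is an anti-Monge matrix if its entries are non-negative and $b_{ij}+b_{rs}\ge b_{is}+b_{rj}$ for all $1\le i<r\le n$, $1\le j<s\le n$. A Toeplitz matrix with generating function $f\colon\{-n+1,\ldots,n-1\}\to\mathbb{R}$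 is the $n\times n$ matrix with $b_{ij}=f(i-j)$. A down-benevolent Toeplitz matrix is a symmetric $n\times n$ Toeplitz matrix whose generating function $f$ satisfies $f(0)=0$, $f(1)\ge f(2)\ge\cdots\ge f(\lceil\frac{n-1}{2}\rceil)$, and $f(i)\ge f(n-i)$ for all $1\le i\le\lceil\frac{n-1}{2}\rceil$. *)

theory Defs
  imports Complex_Main "HOL-Library.Disjoint_Sets" "HOL-Combinatorics.Permutations"
begin

text \<open>An \<open>n \<times> n\<close> matrix is a function \<open>A :: nat \<Rightarrow> nat \<Rightarrow> real\<close> whose entries are \<open>A i j\<close> with
  \<open>i, j \<in> {1..n}\<close>; values at other indices are irrelevant and are never used or constrained.\<close>

type_synonym real_matrix = "nat \<Rightarrow> nat \<Rightarrow> real"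

definition qap_value :: "nat \<Rightarrow> real_matrix \<Rightarrow> real_matrix \<Rightarrow> (nat \<Rightarrow> nat) \<Rightarrow> real" where
  "qap_value n A B \<pi> = (\<Sum>i = 1..n. \<Sum>j = 1..n. A (\<pi> i) (\<pi> j) * B i j)"

definition qap_optimal :: "nat \<Rightarrow> real_matrix \<Rightarrow> real_matrix \<Rightarrow> (nat \<Rightarrow> nat) \<Rightarrow> bool" where
  "qap_optimal n A B \<pi> \<longleftrightarrow>
     \<pi> permutes {1..n} \<and>
     (\<forall>\<sigma>. \<sigma> permutes {1..n} \<longrightarrow> qap_value n A B \<pi> \<le> qap_value n A B \<sigma>)"

definition conic_combination :: "nat \<Rightarrow> real_matrix list \<Rightarrow> real_matrix \<Rightarrow> bool" where
  "conic_combination n Ms A \<longleftrightarrow>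
     (\<exists>c :: nat \<Rightarrow> real.
        (\<forall>k < length Ms. c k \<ge> 0) \<and>
        (\<forall>i \<in> {1..n}. \<forall>j \<in> {1..n}. A i j = (\<Sum>k < length Ms. c k * (Ms ! k) i j)))"

text \<open>The order condition is imposed on all pairs of blocks, not only on adjacent ones: since blocks
  may be empty, the condition on adjacent blocks alone could be voided by inserting empty blocks.\<close>

definition ordered_partition :: "nat \<Rightarrow> nat \<Rightarrow> (nat \<Rightarrow> nat set) \<Rightarrow> bool" where
  "ordered_partition n q I \<longleftrightarrow>
     (\<Union>k \<in> {1..q}. I k) = {1..n} \<and>
     disjoint_family_on I {1..q} \<and>
     (\<forall>k \<in> {1..q}. \<forall>l \<in> {1..q}. k < l \<longrightarrow> (\<forall>x \<in> I k. \<forall>y \<in> I l. x < y))"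

definition cut_matrix_of :: "nat \<Rightarrow> nat \<Rightarrow> (nat \<Rightarrow> nat set) \<Rightarrow> real_matrix \<Rightarrow> bool" where
  "cut_matrix_of n q I A \<longleftrightarrow>
     ordered_partition n q I \<and>
     (\<forall>i \<in> {1..n}. \<forall>j \<in> {1..n}.
        A i j = (if \<exists>k \<in> {1..q}. i \<in> I k \<and> j \<in> I k then 0 else 1))"

definition CDW_cut_matrix :: "nat \<Rightarrow> real_matrix \<Rightarrow> bool" where
  "CDW_cut_matrix n A \<longleftrightarrow>
     (\<exists>q I. cut_matrix_of n q I A \<and>
        (\<forall>k. 1 \<le> k \<and> k + 1 \<le> q \<longrightarrow> card (I k) \<le> card (I (k + 1))))"

definition monotone_matrix :: "nat \<Rightarrow> real_matrix \<Rightarrow> bool" where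
  "monotone_matrix n B \<longleftrightarrow>
     (\<forall>i j. 1 \<le> i \<and> i \<le> n \<and> 1 \<le> j \<and> j + 1 \<le> n \<longrightarrow> B i j \<le> B i (j + 1)) \<and>
     (\<forall>i j. 1 \<le> i \<and> i + 1 \<le> n \<and> 1 \<le> j \<and> j \<le> n \<longrightarrow> B i j \<le> B (i + 1) j)"

definition anti_Monge :: "nat \<Rightarrow> real_matrix \<Rightarrow> bool" where
  "anti_Monge n B \<longleftrightarrow>
     (\<forall>i \<in> {1..n}. \<forall>j \<in> {1..n}. B i j \<ge> 0) \<and>
     (\<forall>i r j s. 1 \<le> i \<and> i < r \<and> r \<le> n \<and> 1 \<le> j \<and> j < s \<and> s \<le> n \<longrightarrow>
        B i j + B r s \<ge> B i s + B r j)"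

text \<open>Only the values of \<open>f\<close> on \<open>{- n + 1..n - 1}\<close> matter.\<close>

definition toeplitz_of :: "nat \<Rightarrow> (int \<Rightarrow> real) \<Rightarrow> real_matrix \<Rightarrow> bool" where
  "toeplitz_of n f B \<longleftrightarrow> (\<forall>i \<in> {1..n}. \<forall>j \<in> {1..n}. B i j = f (int i - int j))"

definition symmetric_matrix :: "nat \<Rightarrow> real_matrix \<Rightarrow> bool" where
  "symmetric_matrix n B \<longleftrightarrow> (\<forall>i \<in> {1..n}. \<forall>j \<in> {1..n}. B i j = B j i)"

definition down_benevolent_toeplitz :: "nat \<Rightarrow> real_matrix \<Rightarrow> bool" where
  "down_benevolent_toeplitz n B \<longleftrightarrow>
     (\<exists>f :: int \<Rightarrow> real.
        toeplitz_of n f B \<and> symmetric_matrix n B \<and>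
        f 0 = 0 \<and>
        (\<forall>i. 1 \<le> i \<and> i + 1 \<le> \<lceil>(real n - 1) / 2\<rceil> \<longrightarrow> f i \<ge> f (i + 1)) \<and>
        (\<forall>i. 1 \<le> i \<and> i \<le> \<lceil>(real n - 1) / 2\<rceil> \<longrightarrow> f i \<ge> f (int n - i)))"

end

theory Submission
  imports Defs
begin

text \<open>The objective is linear in each matrix, so it suffices to treat a single cut matrix against \<open>M\<close> and
against \<open>T\<close>. For a cut matrix with blocks \<open>I\<^sub>1, \<dots>, I\<^sub>q\<close> the objective is the sum of all entries of
\<open>B\<close> minus the sum of the entries \<open>B i j\<close> with \<open>i\<close> and \<open>j\<close> in the same preimage block (lemma
\<open>qap_value_cut_matrix\<close>). A permutation therefore only chooses a partition of \<open>{1..n}\<close> with the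
prescribed block sizes, and the claim is that consecutive blocks of increasing size maximize the total
weight inside the blocks.

For the monotone anti-Monge matrix the blocks compete with each other. Such a matrix is a
non-negative combination of the matrices with \<open>(i, j)\<close> entry \<open>1\<close> if \<open>a \<le> i\<close> and \<open>b \<le> j\<close>, and
\<open>0\<close> otherwise. For one of these the weight is the sum over the blocks of the number of elements
\<open>\<ge> a\<close> times the number of elements \<open>\<ge> b\<close>. With both totals and the block sizes given, this sum
of products is largest when both quantities are packed greedily into the largest blocks (lemma
\<open>sum_mult_le_greedy\<close>), and consecutive blocks of increasing size do exactly that for all \<open>a\<close> and
\<open>b\<close> at once (lemma \<open>ordered_partition_tail_counts\<close>).

For the Toeplitz matrix each block can be treated alone: among all \<open>m\<close>-element subsets of \<open>{1..n}\<close>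
an interval has the largest weight (lemma \<open>benevolent_sum_le_interval\<close>). The generating function is
written as a difference of two functions. The first one depends only on the distance on the cycle of
length \<open>n\<close> and decreases with it; arcs are optimal for it by a rearrangement argument (lemma
\<open>energy_le_arc\<close>): reflect the cycle in an axis and, in each pair of mirror points of which exactly
one is chosen, move the choice to a fixed side of the axis. This never lowers the weight
(lemma \<open>energy_polarize\<close>), and a suitable axis brings the set closer to the desired arc. The second
function, apart from its value at \<open>0\<close> that every set of the given size meets equally often, is
non-negative and lives on differences larger than \<open>n / 2\<close>; an interval has as few pairs with
such a difference as any set of its size (lemma \<open>card_far_pairs_ge\<close>).\<close>

section \<open>Monotone anti-Monge matrices and greedy packing\<close>

definition block_weight :: "real_matrix \<Rightarrow> nat set \<Rightarrow> real" where
  "block_weight B S = (\<Sum>i\<in>S. \<Sum>j\<in>S. B i j)"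

text \<open>The value of \<open>\<Sum>k. x k * y k\<close> when totals \<open>p\<close> and \<open>r\<close> are packed into bins of capacities
\<open>m 1, \<dots>, m q\<close>, filling the bins from the last one down.\<close>
fun greedy :: "(nat \<Rightarrow> nat) \<Rightarrow> nat \<Rightarrow> nat \<Rightarrow> nat \<Rightarrow> nat" where
  "greedy m 0 p r = 0"
| "greedy m (Suc q) p r =
     min (m (Suc q)) p * min (m (Suc q)) r + greedy m q (p - m (Suc q)) (r - m (Suc q))"

text \<open>Two bins, the larger one of capacity \<open>M\<close>, with totals \<open>p = x + x'\<close> and \<open>r = y + y'\<close>. Rearrangement allows both larger shares to be
put into the same bin; with shares \<open>u \<ge> p / 2\<close> and \<open>v \<ge> r / 2\<close> there, the value
\<open>u * v + (p - u) * (r - v)\<close> increases in \<open>u\<close> and in \<open>v\<close>, so this bin may be filled up.\<close>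
lemma two_block_bound:
  fixes x y x' y' M :: nat
  assumes "x \<le> M" "x' \<le> M" "y \<le> M" "y' \<le> M"
  shows "x * y + x' * y' \<le>
    min M (x + x') * min M (y + y') + (x + x' - M) * (y + y' - M)"
proof -
  define u v X Y where "u = int (max x x')" and "v = int (max y y')"
    and "X = int (min M (x + x'))" and "Y = int (min M (y + y'))"
  define p r where "p = int (x + x')" and "r = int (y + y')"
  have b: "u \<le> X" "X \<le> p" "p \<le> 2 * u" "v \<le> Y" "Y \<le> r" "r \<le> 2 * v"
    using assms by (auto simp: u_def v_def X_def Y_def p_def r_def)
  have "int (x * y + x' * y') \<le> u * v + (p - u) * (r - v)"
  proof -
    consider "x \<le> x'" "y \<le> y'" | "x' \<le> x" "y' \<le> y" | "x \<le> x'" "y' \<le> y" | "x' \<le> x" "y \<le> y'"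
      by linarith
    then show ?thesis
    proof cases
      case 1 then show ?thesis by (simp add: u_def v_def p_def r_def)
    next
      case 2 then show ?thesis by (simp add: u_def v_def p_def r_def)
    next
      case 3
      then have "0 \<le> (int x' - int x) * (int y - int y')" by simp
      with 3 show ?thesis by (simp add: u_def v_def p_def r_def max_def algebra_simps)
    next
      case 4
      then have "0 \<le> (int x - int x') * (int y' - int y)" by simp
      with 4 show ?thesis by (simp add: u_def v_def p_def r_def max_def algebra_simps)
    qed
  qed
  also have "\<dots> \<le> X * Y + (p - X) * (r - Y)"
  proof -
    have "0 \<le> (X - u) * (2 * v - r)" "0 \<le> (Y - v) * (2 * X - p)"
      using b by simp_all
    then show ?thesis by (simp add: algebra_simps)
  qed
  also have "\<dots> = int (min M (x + x') * min M (y + y') + (x + x' - M) * (y + y' - M))"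
    by (auto simp: X_def Y_def p_def r_def min_def of_nat_diff)
  finally show ?thesis by linarith
qed

text \<open>Adding a new largest bin to a greedy packing and repacking. The induction first packs the new bin against
the bins below the top one, then balances it against the top one by the two-bin case, and finally
repacks what is left of the top bin, so the hypothesis is used for two different largest bins.\<close>
lemma greedy_push:
  assumes "\<And>i j. 1 \<le> i \<Longrightarrow> i \<le> j \<Longrightarrow> j \<le> q \<Longrightarrow> m i \<le> m j"
    and "\<And>i. 1 \<le> i \<Longrightarrow> i \<le> q \<Longrightarrow> m i \<le> M" and "x \<le> M" and "y \<le> M"
  shows "x * y + greedy m q P R \<le>
    min M (x + P) * min M (y + R) + greedy m q (x + P - M) (y + R - M)"
  using assms
proof (induction q arbitrary: M x y P R)
  case 0
  then show ?case using two_block_bound[of x M 0 y 0] by (simp add: mult_le_mono)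
next
  case (Suc q)
  define m' where "m' = m (Suc q)"
  have m'M: "m' \<le> M" using Suc.prems(2)[of "Suc q"] by (simp add: m'_def)
  define x1 y1 P1 R1 where "x1 = min m' P" and "y1 = min m' R" and "P1 = P - m'" and "R1 = R - m'"
  define x0 y0 P2 R2 where "x0 = min M (x + P1)" and "y0 = min M (y + R1)"
    and "P2 = x + P1 - M" and "R2 = y + R1 - M"
  define x2 y2 where "x2 = x0 + x1 - M" and "y2 = y0 + y1 - M"
  have mono: "\<And>i j. 1 \<le> i \<Longrightarrow> i \<le> j \<Longrightarrow> j \<le> q \<Longrightarrow> m i \<le> m j"
    using Suc.prems(1) by simp
  have 1: "x * y + greedy m q P1 R1 \<le> x0 * y0 + greedy m q P2 R2"
    unfolding x0_def y0_def P2_def R2_def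
    using Suc.prems by (intro Suc.IH) auto
  have 2: "x0 * y0 + x1 * y1 \<le> min M (x0 + x1) * min M (y0 + y1) + x2 * y2"
    unfolding x2_def y2_def using m'M
    by (intro two_block_bound) (auto simp: x0_def y0_def x1_def y1_def)
  have "x2 \<le> m'" "y2 \<le> m'"
    by (auto simp: x2_def y2_def x0_def y0_def x1_def y1_def)
  then have 3: "x2 * y2 + greedy m q P2 R2 \<le>
      min m' (x2 + P2) * min m' (y2 + R2) + greedy m q (x2 + P2 - m') (y2 + R2 - m')"
    using Suc.prems(1) by (intro Suc.IH) (auto simp: m'_def)
  have 4: "min M (x0 + x1) = min M (x + P)" "min M (y0 + y1) = min M (y + R)"
    "x2 + P2 = x + P - M" "y2 + R2 = y + R - M"
    using m'M Suc.prems(3,4)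
    by (auto simp: x0_def x1_def y0_def y1_def P1_def R1_def x2_def y2_def P2_def R2_def min_def)
  have "x * y + greedy m (Suc q) P R = x * y + x1 * y1 + greedy m q P1 R1"
    by (simp add: x1_def y1_def P1_def R1_def m'_def)
  also have "\<dots> \<le> min M (x + P) * min M (y + R)
      + (min m' (x + P - M) * min m' (y + R - M)
      + greedy m q (x + P - M - m') (y + R - M - m'))"
    using 1 2 3 unfolding 4 by linarith
  finally show ?case by (simp add: m'_def)
qed

lemma sum_mult_le_greedy:
  assumes "\<And>i j. 1 \<le> i \<Longrightarrow> i \<le> j \<Longrightarrow> j \<le> q \<Longrightarrow> m i \<le> m j"
    and "\<And>k. 1 \<le> k \<Longrightarrow> k \<le> q \<Longrightarrow> x k \<le> m k \<and> y k \<le> m k"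
  shows "(\<Sum>k = 1..q. x k * y k) \<le> greedy m q (\<Sum>k = 1..q. x k) (\<Sum>k = 1..q. y k)"
  using assms
proof (induction q)
  case (Suc q)
  have "(\<Sum>k = 1..q. x k * y k) \<le> greedy m q (\<Sum>k = 1..q. x k) (\<Sum>k = 1..q. y k)"
    using Suc.prems by (intro Suc.IH) auto
  moreover have "x (Suc q) * y (Suc q) + greedy m q (\<Sum>k = 1..q. x k) (\<Sum>k = 1..q. y k)
      \<le> greedy m (Suc q) (x (Suc q) + (\<Sum>k = 1..q. x k)) (y (Suc q) + (\<Sum>k = 1..q. y k))"
    unfolding greedy.simps
    using Suc.prems(1) Suc.prems(2)[of "Suc q"] by (intro greedy_push) auto
  ultimately show ?case by (simp add: add.commute)
qed simp

text \<open>The hypotheses describe the greedy packing: a bin takes everything that the bins up to and including it hold,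
as far as its capacity allows.\<close>
lemma greedy_eq_sum_mult:
  assumes "\<And>k. 1 \<le> k \<Longrightarrow> k \<le> q \<Longrightarrow> x k = min (m k) (\<Sum>l = 1..k. x l)"
    and "\<And>k. 1 \<le> k \<Longrightarrow> k \<le> q \<Longrightarrow> y k = min (m k) (\<Sum>l = 1..k. y l)"
  shows "greedy m q (\<Sum>k = 1..q. x k) (\<Sum>k = 1..q. y k) = (\<Sum>k = 1..q. x k * y k)"
  using assms
proof (induction q)
  case (Suc q)
  have IH: "greedy m q (\<Sum>k = 1..q. x k) (\<Sum>k = 1..q. y k) = (\<Sum>k = 1..q. x k * y k)"
    by (rule Suc.IH; rule Suc.prems; simp)
  have peel: "min (m (Suc q)) (\<Sum>l = 1..Suc q. z l) = z (Suc q)"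
      "(\<Sum>l = 1..Suc q. z l) - m (Suc q) = (\<Sum>l = 1..q. z l)"
    if z: "z (Suc q) = min (m (Suc q)) (\<Sum>l = 1..Suc q. z l)" for z :: "nat \<Rightarrow> nat"
  proof -
    show "min (m (Suc q)) (\<Sum>l = 1..Suc q. z l) = z (Suc q)" using z by (rule sym)
    have "t - b = s" if "a = min b t" "t = s + a" for a b s t :: nat using that by linarith
    from this[OF z] show "(\<Sum>l = 1..Suc q. z l) - m (Suc q) = (\<Sum>l = 1..q. z l)" by simp
  qed
  have last: "x (Suc q) = min (m (Suc q)) (\<Sum>l = 1..Suc q. x l)"
    "y (Suc q) = min (m (Suc q)) (\<Sum>l = 1..Suc q. y l)"
    by (rule Suc.prems; simp)+
  show ?case unfolding greedy.simps peel[OF last(1)] peel[OF last(2)] IH by simp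
qed simp

lemma telescope_2d:
  fixes M :: real_matrix
  assumes "\<And>i. M i 0 = 0" "\<And>j. M 0 j = 0"
  shows "(\<Sum>a = 1..i. \<Sum>b = 1..j. M a b - M (a - 1) b - M a (b - 1) + M (a - 1) (b - 1)) = M i j"
proof -
  have 1: "(\<Sum>b = 1..j. M a b - M (a - 1) b - M a (b - 1) + M (a - 1) (b - 1))
      = M a j - M (a - 1) j" for a
    by (induction j) (auto simp: assms)
  show ?thesis unfolding 1 by (induction i) (auto simp: assms)
qed

lemma ordered_partition_subset:
  "ordered_partition n q I \<Longrightarrow> k \<in> {1..q} \<Longrightarrow> I k \<subseteq> {1..n}"
  unfolding ordered_partition_def by blast

text \<open>If block \<open>k\<close> is not contained in \<open>{a..}\<close>, it has an element below \<open>a\<close>, and then all elements of the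
earlier blocks are below \<open>a\<close> as well.\<close>
lemma ordered_partition_tail_counts:
  assumes "ordered_partition n q I" "k \<in> {1..q}"
  shows "card (I k \<inter> {a..}) = min (card (I k)) (\<Sum>l = 1..k. card (I l \<inter> {a..}))"
proof (cases "I k \<subseteq> {a..}")
  case True
  have "(\<Sum>l = 1..k. card (I l \<inter> {a..})) \<ge> card (I k \<inter> {a..})"
    using assms(2) by (intro member_le_sum) auto
  moreover have "I k \<inter> {a..} = I k" using True by blast
  ultimately show ?thesis by simp
next
  case False
  then obtain z where z: "z \<in> I k" "z < a" by (meson atLeast_iff linorder_not_le subsetI)
  have "I l \<inter> {a..} = {}" if "l \<in> {1..k} - {k}" for l
  proof -
    have "\<forall>x\<in>I l. x < z"
    proof -
      have "l \<in> {1..q}" "l < k" using that assms(2) by auto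
      then show ?thesis using assms z(1) unfolding ordered_partition_def by blast
    qed
    then show ?thesis using z(2) by auto
  qed
  then have "(\<Sum>l = 1..k. card (I l \<inter> {a..})) = card (I k \<inter> {a..})"
    using assms(2) by (subst sum.remove[of _ k]) auto
  moreover have "card (I k \<inter> {a..}) \<le> card (I k)"
    using finite_subset[OF ordered_partition_subset[OF assms]] by (intro card_mono) auto
  ultimately show ?thesis by simp
qed

lemma sum_card_partition:
  fixes n q :: nat
  assumes "disjoint_family_on S {1..q}" "(\<Union>k\<in>{1..q}. S k) = {1..n::nat}"
  shows "(\<Sum>k = 1..q. card (S k \<inter> A)) = card ({1..n} \<inter> A)"
proof -
  have "finite (S k)" if "k \<in> {1..q}" for k
    using that assms(2) by (intro finite_subset[of "S k" "{1..n}"]) auto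
  then have "card (\<Union>k\<in>{1..q}. S k \<inter> A) = (\<Sum>k = 1..q. card (S k \<inter> A))"
    using assms(1) by (intro card_UN_disjoint) (auto simp: disjoint_family_on_def)
  moreover have "(\<Union>k\<in>{1..q}. S k \<inter> A) = {1..n} \<inter> A" using assms(2) by blast
  ultimately show ?thesis by simp
qed

lemma block_weight_layers:
  assumes "S \<subseteq> {1..n}"
    and M: "\<And>i j. i \<in> {1..n} \<Longrightarrow> j \<in> {1..n} \<Longrightarrow> M i j = (\<Sum>a = 1..i. \<Sum>b = 1..j. w a b)"
  shows "block_weight M S =
    (\<Sum>a = 1..n. \<Sum>b = 1..n. w a b * real (card (S \<inter> {a..}) * card (S \<inter> {b..})))"
proof -
  have fin: "finite S" using assms(1) finite_subset by blast
  have card: "real (card (S \<inter> {a..})) = (\<Sum>i\<in>S. of_bool (a \<le> i))" for a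
  proof -
    have "S \<inter> Collect ((\<le>) a) = S \<inter> {a..}" by auto
    then show ?thesis using fin by simp
  qed
  have "block_weight M S =
      (\<Sum>i\<in>S. \<Sum>j\<in>S. \<Sum>a = 1..n. \<Sum>b = 1..n. w a b * (of_bool (a \<le> i) * of_bool (b \<le> j)))"
    unfolding block_weight_def
  proof (intro sum.cong refl)
    fix i j assume ij: "i \<in> S" "j \<in> S"
    then have mem: "i \<in> {1..n}" "j \<in> {1..n}" using assms(1) by auto
    have sub: "(\<Sum>b = 1..n. g b * of_bool (b \<le> j)) = (\<Sum>b = 1..j. g b)" if "j \<in> {1..n}"
      for j and g :: "nat \<Rightarrow> real"
      using that by (intro sum.mono_neutral_cong_right) auto
    have "M i j = (\<Sum>a = 1..n. (\<Sum>b = 1..n. w a b * of_bool (b \<le> j)) * of_bool (a \<le> i))"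
      unfolding sub[OF mem(2)] sub[OF mem(1)] by (rule M[OF mem])
    then show "M i j = (\<Sum>a = 1..n. \<Sum>b = 1..n. w a b * (of_bool (a \<le> i) * of_bool (b \<le> j)))"
      by (simp only: sum_distrib_right mult.assoc mult.commute[of "of_bool (_ \<le> j)"])
  qed
  also have "\<dots> = (\<Sum>a = 1..n. \<Sum>b = 1..n. \<Sum>i\<in>S. \<Sum>j\<in>S. w a b * (of_bool (a \<le> i) * of_bool (b \<le> j)))"
  proof -
    let ?g = "\<lambda>i j a b. w a b * (of_bool (a \<le> i) * of_bool (b \<le> j)) :: real"
    have "(\<Sum>i\<in>S. \<Sum>j\<in>S. \<Sum>a = 1..n. \<Sum>b = 1..n. ?g i j a b)
        = (\<Sum>i\<in>S. \<Sum>a = 1..n. \<Sum>b = 1..n. \<Sum>j\<in>S. ?g i j a b)"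
    proof (rule sum.cong[OF refl])
      fix i
      have "(\<Sum>j\<in>S. \<Sum>a = 1..n. \<Sum>b = 1..n. ?g i j a b)
          = (\<Sum>a = 1..n. \<Sum>j\<in>S. \<Sum>b = 1..n. ?g i j a b)"
        by (rule sum.swap)
      also have "\<dots> = (\<Sum>a = 1..n. \<Sum>b = 1..n. \<Sum>j\<in>S. ?g i j a b)"
        by (intro sum.cong refl sum.swap)
      finally show "(\<Sum>j\<in>S. \<Sum>a = 1..n. \<Sum>b = 1..n. ?g i j a b)
          = (\<Sum>a = 1..n. \<Sum>b = 1..n. \<Sum>j\<in>S. ?g i j a b)" .
    qed
    also have "\<dots> = (\<Sum>a = 1..n. \<Sum>i\<in>S. \<Sum>b = 1..n. \<Sum>j\<in>S. ?g i j a b)"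
      by (rule sum.swap)
    also have "\<dots> = (\<Sum>a = 1..n. \<Sum>b = 1..n. \<Sum>i\<in>S. \<Sum>j\<in>S. ?g i j a b)"
      by (intro sum.cong refl sum.swap)
    finally show ?thesis .
  qed
  also have "\<dots> = (\<Sum>a = 1..n. \<Sum>b = 1..n. w a b * real (card (S \<inter> {a..}) * card (S \<inter> {b..})))"
    unfolding of_nat_mult card sum_product by (simp add: sum_distrib_left)
  finally show ?thesis .
qed

text \<open>The coefficients are the mixed second differences of \<open>M\<close> bordered by a row and a column of zeros. They
are non-negative in the interior by the anti-Monge inequality, along the border by monotonicity, and at
the corner because the entries of \<open>M\<close> are.\<close>
lemma monotone_anti_Monge_layers:
  assumes "monotone_matrix n M" "anti_Monge n M"
  obtains w where "\<And>a b. a \<in> {1..n} \<Longrightarrow> b \<in> {1..n} \<Longrightarrow> w a b \<ge> 0"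
    and "\<And>i j. i \<in> {1..n} \<Longrightarrow> j \<in> {1..n} \<Longrightarrow> M i j = (\<Sum>a = 1..i. \<Sum>b = 1..j. w a b :: real)"
proof
  define M0 where "M0 i j = (if i = 0 \<or> j = 0 then 0 else M i j)" for i j
  define w where "w a b = M0 a b - M0 (a - 1) b - M0 a (b - 1) + M0 (a - 1) (b - 1)" for a b
  show "M i j = (\<Sum>a = 1..i. \<Sum>b = 1..j. w a b)" if "i \<in> {1..n}" "j \<in> {1..n}" for i j
    unfolding w_def using that by (subst telescope_2d) (auto simp: M0_def)
  have mono1: "M i j \<le> M i (Suc j)" if "1 \<le> i" "i \<le> n" "1 \<le> j" "Suc j \<le> n" for i j
    using assms(1) that unfolding monotone_matrix_def by auto
  have mono2: "M i j \<le> M (Suc i) j" if "1 \<le> i" "Suc i \<le> n" "1 \<le> j" "j \<le> n" for i j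
    using assms(1) that unfolding monotone_matrix_def by auto
  have monge: "M i j + M (Suc i) (Suc j) \<ge> M i (Suc j) + M (Suc i) j"
    if "1 \<le> i" "Suc i \<le> n" "1 \<le> j" "Suc j \<le> n" for i j
    using assms(2) that unfolding anti_Monge_def by auto
  show "w a b \<ge> 0" if ab: "a \<in> {1..n}" "b \<in> {1..n}" for a b
  proof -
    obtain a' b' where [simp]: "a = Suc a'" "b = Suc b'"
      using ab by (metis atLeastAtMost_iff Suc_le_D One_nat_def)
    have "0 \<le> M a b" using assms(2) ab unfolding anti_Monge_def by auto
    then show ?thesis
      using ab mono1[of a b'] mono2[of a' b] monge[of a' b']
      by (cases "a' = 0"; cases "b' = 0") (auto simp: w_def M0_def)
  qed
qed

lemma anti_Monge_consecutive_optimal: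
  assumes M: "monotone_matrix n M" "anti_Monge n M"
    and I: "ordered_partition n q I"
    and mono: "\<And>i j. 1 \<le> i \<Longrightarrow> i \<le> j \<Longrightarrow> j \<le> q \<Longrightarrow> card (I i) \<le> card (I j)"
    and S: "disjoint_family_on S {1..q}" "(\<Union>k\<in>{1..q}. S k) = {1..n}"
    and card: "\<And>k. k \<in> {1..q} \<Longrightarrow> card (S k) = card (I k)"
  shows "(\<Sum>k = 1..q. block_weight M (S k)) \<le> (\<Sum>k = 1..q. block_weight M (I k))"
proof -
  obtain w where w: "\<And>a b. a \<in> {1..n} \<Longrightarrow> b \<in> {1..n} \<Longrightarrow> w a b \<ge> 0"
    "\<And>i j. i \<in> {1..n} \<Longrightarrow> j \<in> {1..n} \<Longrightarrow> M i j = (\<Sum>a = 1..i. \<Sum>b = 1..j. w a b)"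
    using monotone_anti_Monge_layers[OF M] by blast
  have layers: "(\<Sum>k = 1..q. block_weight M (X k)) =
      (\<Sum>a = 1..n. \<Sum>b = 1..n. w a b * real (\<Sum>k = 1..q. card (X k \<inter> {a..}) * card (X k \<inter> {b..})))"
    if "\<And>k. k \<in> {1..q} \<Longrightarrow> X k \<subseteq> {1..n}" for X
  proof -
    have "(\<Sum>k = 1..q. block_weight M (X k)) = (\<Sum>k = 1..q. \<Sum>a = 1..n. \<Sum>b = 1..n.
        w a b * real (card (X k \<inter> {a..}) * card (X k \<inter> {b..})))"
      using that w(2) by (intro sum.cong refl block_weight_layers) auto
    also have "\<dots> = (\<Sum>a = 1..n. \<Sum>k = 1..q. \<Sum>b = 1..n.
        w a b * real (card (X k \<inter> {a..}) * card (X k \<inter> {b..})))"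
      by (rule sum.swap)
    also have "\<dots> = (\<Sum>a = 1..n. \<Sum>b = 1..n. \<Sum>k = 1..q.
        w a b * real (card (X k \<inter> {a..}) * card (X k \<inter> {b..})))"
      by (intro sum.cong refl sum.swap)
    finally show ?thesis by (simp only: of_nat_sum sum_distrib_left)
  qed
  have le: "(\<Sum>k = 1..q. card (S k \<inter> {a..}) * card (S k \<inter> {b..}))
      \<le> (\<Sum>k = 1..q. card (I k \<inter> {a..}) * card (I k \<inter> {b..}))" for a b
  proof -
    have I': "disjoint_family_on I {1..q}" "(\<Union>k\<in>{1..q}. I k) = {1..n}"
      using I unfolding ordered_partition_def by auto
    have fin: "finite (S k)" if "k \<in> {1..q}" for k
      using that S(2) by (intro finite_subset[of "S k" "{1..n}"]) auto
    have "card (S k \<inter> A) \<le> card (I k)" if "k \<in> {1..q}" for k A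
      using that fin card by (metis card_mono inf_le1)
    then have "(\<Sum>k = 1..q. card (S k \<inter> {a..}) * card (S k \<inter> {b..}))
        \<le> greedy (\<lambda>k. card (I k)) q (\<Sum>k = 1..q. card (S k \<inter> {a..})) (\<Sum>k = 1..q. card (S k \<inter> {b..}))"
      using mono by (intro sum_mult_le_greedy) auto
    also have "\<dots> = greedy (\<lambda>k. card (I k)) q
        (\<Sum>k = 1..q. card (I k \<inter> {a..})) (\<Sum>k = 1..q. card (I k \<inter> {b..}))"
      by (simp only: sum_card_partition[OF S] sum_card_partition[OF I'])
    also have "\<dots> = (\<Sum>k = 1..q. card (I k \<inter> {a..}) * card (I k \<inter> {b..}))"
      by (intro greedy_eq_sum_mult ordered_partition_tail_counts[OF I]) auto
    finally show ?thesis .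
  qed
  have "(\<Sum>k = 1..q. block_weight M (S k)) = (\<Sum>a = 1..n. \<Sum>b = 1..n.
      w a b * real (\<Sum>k = 1..q. card (S k \<inter> {a..}) * card (S k \<inter> {b..})))"
    using S(2) by (intro layers) blast
  also have "\<dots> \<le> (\<Sum>a = 1..n. \<Sum>b = 1..n.
      w a b * real (\<Sum>k = 1..q. card (I k \<inter> {a..}) * card (I k \<inter> {b..})))"
    using w(1) by (intro sum_mono mult_left_mono of_nat_mono[OF le])
  also have "\<dots> = (\<Sum>k = 1..q. block_weight M (I k))"
    using ordered_partition_subset[OF I] by (intro layers[symmetric])
  finally show ?thesis .
qed

section \<open>Polarization on a cycle\<close>

text \<open>The reflection \<open>u \<mapsto> s - u\<close> of the cycle of residues modulo \<open>N\<close> has an axis through \<open>s / 2\<close> and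
\<open>(s + N) / 2\<close>. The value is \<open>0\<close> on the axis, \<open>1\<close> on the half cycle just before \<open>s / 2\<close> and \<open>- 1\<close> on
its mirror image. Working with \<open>2 * u - s\<close> modulo \<open>2 * N\<close> avoids half-integers.\<close>
definition side :: "int \<Rightarrow> int \<Rightarrow> int \<Rightarrow> real" where
  "side N s u = (let r = (2 * u - s) mod (2 * N) in
     if r = 0 \<or> r = N then 0 else if r > N then 1 else - 1)"

text \<open>This is the larger of \<open>\<chi> u\<close> and \<open>\<chi> (s - u)\<close> on the positive side, the smaller one on the negative
side, and for periodic \<open>\<chi>\<close> it is \<open>\<chi> u\<close> on the axis. In this form the sum over a mirror pair is
unchanged and the difference becomes its absolute value up to the sign \<open>side N s u\<close>.\<close>
definition polarize :: "int \<Rightarrow> int \<Rightarrow> (int \<Rightarrow> real) \<Rightarrow> int \<Rightarrow> real" where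
  "polarize N s \<chi> u = (\<chi> u + \<chi> (s - u) + side N s u * \<bar>\<chi> u - \<chi> (s - u)\<bar>) / 2"

definition energy :: "int \<Rightarrow> (int \<Rightarrow> real) \<Rightarrow> (int \<Rightarrow> real) \<Rightarrow> real" where
  "energy N K \<chi> = (\<Sum>u = 1..N. \<Sum>v = 1..N. \<chi> u * \<chi> v * K (u - v))"

definition cyclic :: "int \<Rightarrow> (int \<Rightarrow> 'a) \<Rightarrow> bool" where
  "cyclic N F \<longleftrightarrow> (\<forall>u. F (u + N) = F u)"

lemma cyclicD: "cyclic N F \<Longrightarrow> F (u + N) = F u"
  by (simp add: cyclic_def)

lemma cyclic_mult_nat:
  assumes "cyclic N F" shows "F (u + int k * N) = F u"
proof (induction k)
  case (Suc k)
  have "F (u + int (Suc k) * N) = F ((u + int k * N) + N)" by (simp add: algebra_simps)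
  then show ?case using Suc cyclicD[OF assms] by metis
qed simp

lemma cyclic_mult:
  assumes "cyclic N F" shows "F (u + k * N) = F u"
proof (cases "k \<ge> 0")
  case True then show ?thesis using cyclic_mult_nat[OF assms, of u "nat k"] by simp
next
  case False
  then show ?thesis using cyclic_mult_nat[OF assms, of "u + k * N" "nat (- k)"]
    by (simp add: algebra_simps)
qed

lemma cyclic_cong:
  assumes "cyclic N F" "u mod N = v mod N" shows "F u = F v"
proof -
  have "u = v + (u div N - v div N) * N"
    using assms(2) div_mult_mod_eq[of u N] div_mult_mod_eq[of v N] by (simp only: left_diff_distrib)
  then show ?thesis using cyclic_mult[OF assms(1)] by metis
qed

lemma sum_cyclic_reflect:
  fixes F :: "int \<Rightarrow> real"
  assumes "cyclic N F" "N > 0"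
  shows "(\<Sum>u = 1..N. F (s - u)) = (\<Sum>u = 1..N. F u)"
proof (rule sum.reindex_bij_witness[of _ "\<lambda>u. (s - u - 1) mod N + 1" "\<lambda>u. (s - u - 1) mod N + 1"])
  have *: "(s - ((s - u - 1) mod N + 1) - 1) mod N + 1 = u" if "u \<in> {1..N}" for u
  proof -
    have "(s - ((s - u - 1) mod N + 1) - 1) mod N = (s - 2 - (s - u - 1) mod N) mod N"
      by (simp add: algebra_simps)
    also have "\<dots> = (s - 2 - (s - u - 1)) mod N" by (rule mod_diff_right_eq)
    also have "\<dots> = u - 1" using that by (simp add: mod_pos_pos_trivial)
    finally show ?thesis by simp
  qed
  show "(s - ((s - u - 1) mod N + 1) - 1) mod N + 1 = u" if "u \<in> {1..N}" for u using * that .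
  show "(s - ((s - u - 1) mod N + 1) - 1) mod N + 1 = u" if "u \<in> {1..N}" for u using * that .
  show "(s - u - 1) mod N + 1 \<in> {1..N}" for u
    using pos_mod_bound[OF assms(2), of "s - u - 1"] pos_mod_sign[OF assms(2), of "s - u - 1"] by auto
  show "(s - u - 1) mod N + 1 \<in> {1..N}" for u
    using pos_mod_bound[OF assms(2), of "s - u - 1"] pos_mod_sign[OF assms(2), of "s - u - 1"] by auto
  show "F ((s - u - 1) mod N + 1) = F (s - u)" for u
    by (rule cyclic_cong[OF assms(1)]) (simp add: mod_add_left_eq)
qed

lemma cyclic_side: "cyclic N (side N s)"
proof -
  have "(2 * (u + N) - s) mod (2 * N) = (2 * u - s) mod (2 * N)" for u
  proof -
    have "2 * (u + N) - s = 2 * u - s + 2 * N" by simp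
    then show ?thesis by (simp only: mod_add_self2)
  qed
  then show ?thesis unfolding cyclic_def side_def by simp
qed

text \<open>Every residue has a representative in the window of length \<open>N\<close> centered at \<open>s / 2\<close>, where the
sides of the axis are described by plain inequalities.\<close>
lemma centered_lift:
  assumes "N > 0"
  obtains u' :: int where "u' mod N = u mod N" "- N < 2 * u' - s" "2 * u' - s \<le> N"
proof
  define a where "a = (s - N) div 2 + 1"
  define u' where "u' = a + (u - a) mod N"
  show "u' mod N = u mod N" unfolding u'_def by (simp add: mod_add_right_eq)
  have "0 \<le> (u - a) mod N" "(u - a) mod N < N" using assms by auto
  moreover have "s - N < 2 * a" "2 * a \<le> s - N + 2" unfolding a_def by auto
  ultimately have "- N < 2 * (a + t) - s \<and> 2 * (a + t) - s \<le> N" if "t = (u - a) mod N" for t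
    using that by auto
  then have "- N < 2 * u' - s \<and> 2 * u' - s \<le> N" unfolding u'_def by blast
  then show "- N < 2 * u' - s" "2 * u' - s \<le> N" by auto
qed

lemma side_centered:
  assumes "N > 0" "- N < 2 * u - s" "2 * u - s \<le> N"
  shows "side N s u = (if 2 * u = s \<or> 2 * u = s + N then 0 else if 2 * u < s then 1 else - 1)"
proof (cases "2 * u < s")
  case True
  have "(2 * u - s) mod (2 * N) = (2 * u - s + 2 * N) mod (2 * N)" by simp
  also have "\<dots> = 2 * u - s + 2 * N" using True assms by (intro mod_pos_pos_trivial) auto
  finally show ?thesis using True assms by (auto simp: side_def)
next
  case False
  then have "(2 * u - s) mod (2 * N) = 2 * u - s" using assms by (intro mod_pos_pos_trivial) auto
  then show ?thesis using False assms by (auto simp: side_def)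
qed

lemma side_reflect:
  assumes "N > 0" shows "side N s (s - u) = - side N s u"
proof -
  obtain v where v: "v mod N = u mod N" "- N < 2 * v - s" "2 * v - s \<le> N"
    using centered_lift[OF assms] by blast
  have 1: "side N s u = side N s v" using cyclic_cong[OF cyclic_side] v(1) by metis
  have "(s - u) mod N = (s - v) mod N"
    by (rule mod_diff_cong) (simp_all add: v(1))
  then have 2: "side N s (s - u) = side N s (s - v)" using cyclic_cong[OF cyclic_side] by blast
  have "side N s (s - v) = - side N s v"
  proof (cases "2 * v = s + N")
    case True
    have "side N s (s - v) = side N s v"
    proof (rule cyclic_cong[OF cyclic_side])
      have "s - v = v + (- 1) * N" using True by simp
      then show "(s - v) mod N = v mod N" by (simp only: mod_mult_self1)
    qed
    then show ?thesis using side_centered[OF assms v(2,3)] True by simp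
  next
    case False
    then show ?thesis
      using side_centered[OF assms v(2,3)] side_centered[OF assms, of "s - v" s] v(2,3) by auto
  qed
  then show ?thesis using 1 2 by simp
qed

lemma side_zero_fixed:
  assumes "N > 0" "side N s u = 0" "cyclic N F" shows "F (s - u) = F u"
proof (rule cyclic_cong[OF assms(3)])
  obtain v where v: "v mod N = u mod N" "- N < 2 * v - s" "2 * v - s \<le> N"
    using centered_lift[OF assms(1)] by blast
  have "side N s v = 0" using cyclic_cong[OF cyclic_side v(1)] assms(2) by simp
  then have "s - v = v \<or> s - v = v + (- 1) * N"
    using side_centered[OF assms(1) v(2,3)] by (auto split: if_splits)
  then have "(s - v) mod N = v mod N"
  proof
    assume "s - v = v + (- 1) * N"
    then show ?thesis by (simp only: mod_mult_self1)
  qed (rule arg_cong)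
  moreover have "(s - u) mod N = (s - v) mod N"
    by (rule mod_diff_cong) (simp_all add: v(1))
  ultimately show "(s - u) mod N = u mod N" using v(1) by simp
qed

lemma side_cases: "side N s u = 0 \<or> side N s u = 1 \<or> side N s u = - 1"
  by (auto simp: side_def Let_def)

lemma cyclic_reflect: "cyclic N \<chi> \<Longrightarrow> \<chi> (s - (u + N)) = \<chi> (s - u)"
  using cyclicD[of N \<chi> "s - (u + N)"] by simp

lemma cyclic_polarize:
  assumes "cyclic N \<chi>" shows "cyclic N (polarize N s \<chi>)"
  unfolding cyclic_def polarize_def
  using cyclicD[OF assms] cyclicD[OF cyclic_side] cyclic_reflect[OF assms] by simp

lemma polarize_reflect:
  assumes "N > 0"
  shows "polarize N s \<chi> (s - u) = (\<chi> u + \<chi> (s - u) - side N s u * \<bar>\<chi> u - \<chi> (s - u)\<bar>) / 2"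
  unfolding polarize_def side_reflect[OF assms] abs_minus_commute[of "\<chi> (s - u)"] by simp

lemma polarize_add:
  assumes "N > 0"
  shows "polarize N s \<chi> u + polarize N s \<chi> (s - u) = \<chi> u + \<chi> (s - u)"
proof -
  have "(a + b) / 2 + (a - b) / 2 = a" for a b :: real by (simp add: field_simps)
  then show ?thesis unfolding polarize_reflect[OF assms] unfolding polarize_def by blast
qed

lemma polarize_diff:
  assumes "N > 0"
  shows "polarize N s \<chi> u - polarize N s \<chi> (s - u) = side N s u * \<bar>\<chi> u - \<chi> (s - u)\<bar>"
proof -
  have "(a + b) / 2 - (a - b) / 2 = b" for a b :: real by (simp add: field_simps)
  then show ?thesis unfolding polarize_reflect[OF assms] unfolding polarize_def by blast
qed

lemma polarize_01:
  assumes "N > 0" "cyclic N \<chi>" "\<And>u. \<chi> u \<in> {0, 1}"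
  shows "polarize N s \<chi> u \<in> {0, 1}"
proof -
  have fixed: "\<chi> (s - u) = \<chi> u" if "side N s u = 0"
    using side_zero_fixed[OF assms(1) that assms(2)] .
  have *: "(a + b + e * \<bar>a - b\<bar>) / 2 \<in> {0, 1}"
    if "a \<in> {0, 1}" "b \<in> {0, 1}" "e = 0 \<or> e = 1 \<or> e = - 1" "e = 0 \<Longrightarrow> b = a" for a b e :: real
    using that by auto
  show ?thesis unfolding polarize_def using fixed
    by (rule *[OF assms(3) assms(3) side_cases])
qed

text \<open>Averaging over the reflection separates sums and differences of mirror pairs. Polarization affects only
the differences.\<close>
lemma sum_mult_symmetrized:
  fixes \<phi> \<psi> :: "int \<Rightarrow> real"
  assumes "N > 0" "cyclic N \<phi>" "cyclic N \<psi>"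
  shows "4 * (\<Sum>u = 1..N. \<phi> u * \<psi> u) =
    (\<Sum>u = 1..N. (\<phi> u + \<phi> (s - u)) * (\<psi> u + \<psi> (s - u)) + (\<phi> u - \<phi> (s - u)) * (\<psi> u - \<psi> (s - u)))"
proof -
  have "cyclic N (\<lambda>u. \<phi> u * \<psi> u)" using assms by (simp add: cyclic_def)
  then have "(\<Sum>u = 1..N. \<phi> (s - u) * \<psi> (s - u)) = (\<Sum>u = 1..N. \<phi> u * \<psi> u)"
    using sum_cyclic_reflect[of N "\<lambda>u. \<phi> u * \<psi> u" s] assms(1) by simp
  moreover have "(\<Sum>u = 1..N. (\<phi> u + \<phi> (s - u)) * (\<psi> u + \<psi> (s - u)) + (\<phi> u - \<phi> (s - u)) * (\<psi> u - \<psi> (s - u)))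
      = (\<Sum>u = 1..N. 2 * (\<phi> u * \<psi> u) + 2 * (\<phi> (s - u) * \<psi> (s - u)))"
    by (intro sum.cong) (auto simp: algebra_simps)
  ultimately show ?thesis by (simp add: sum.distrib flip: sum_distrib_left)
qed

lemma sum_polarize:
  assumes "N > 0" "cyclic N \<chi>"
  shows "(\<Sum>u = 1..N. polarize N s \<chi> u) = (\<Sum>u = 1..N. \<chi> u)"
proof -
  have "2 * (\<Sum>u = 1..N. \<phi> u) = (\<Sum>u = 1..N. \<phi> u + \<phi> (s - u))" if "cyclic N \<phi>" for \<phi> :: "int \<Rightarrow> real"
    using sum_cyclic_reflect[OF that assms(1), of s] by (simp add: sum.distrib)
  from this[OF assms(2)] this[OF cyclic_polarize[OF assms(2)], of s] show ?thesis
    unfolding polarize_add[OF assms(1)] by linarith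
qed

section \<open>Arcs maximize decreasing cyclic kernels\<close>

text \<open>The last condition says that \<open>K\<close> decreases with the distance on the cycle, without naming that
distance: \<open>\<bar>a\<bar> \<le> N - \<bar>b\<bar>\<close> and \<open>\<bar>a\<bar> \<le> \<bar>b\<bar>\<close> bound \<open>\<bar>a\<bar>\<close> by the
cyclic length of \<open>b\<close>.\<close>
locale cyclic_kernel =
  fixes N :: int and K :: "int \<Rightarrow> real"
  assumes N_pos: "N > 0"
    and K_cyclic: "cyclic N K"
    and K_even: "K (- z) = K z"
    and K_antimono: "\<bar>a\<bar> \<le> \<bar>b\<bar> \<Longrightarrow> \<bar>a\<bar> + \<bar>b\<bar> \<le> N \<Longrightarrow> K b \<le> K a"
begin

text \<open>The energy is invariant under reflecting both arguments, and reflecting one of them replaces \<open>u - v\<close> by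
\<open>u + v - s\<close> up to sign. The factor is \<open>8\<close> because four versions of the energy are added and products
are then expressed by sums and differences, which costs another factor \<open>2\<close>.\<close>
lemma energy_symmetrized:
  assumes "cyclic N \<chi>"
  shows "8 * energy N K \<chi> = (\<Sum>u = 1..N. \<Sum>v = 1..N.
     (\<chi> u + \<chi> (s - u)) * (\<chi> v + \<chi> (s - v)) * (K (u - v) + K (u + v - s))
   + (\<chi> u - \<chi> (s - u)) * (\<chi> v - \<chi> (s - v)) * (K (u - v) - K (u + v - s)))"
proof -
  have K: "K (x + N) = K x" "K (x - N) = K x" for x
    using cyclicD[OF K_cyclic, of x] cyclicD[OF K_cyclic, of "x - N"] by simp_all
  have ch: "\<chi> (x + N) = \<chi> x" for x using cyclicD[OF assms] by metis
  have 1: "energy N K \<chi> = (\<Sum>u = 1..N. \<Sum>v = 1..N. \<chi> u * \<chi> (s - v) * K (u + v - s))"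
    unfolding energy_def
  proof (rule sum.cong[OF refl])
    fix u
    have "cyclic N (\<lambda>v. \<chi> u * \<chi> v * K (u - v))"
      unfolding cyclic_def diff_diff_eq[symmetric] K(2) ch by simp
    from sum_cyclic_reflect[OF this N_pos, of s]
    show "(\<Sum>v = 1..N. \<chi> u * \<chi> v * K (u - v)) = (\<Sum>v = 1..N. \<chi> u * \<chi> (s - v) * K (u + v - s))"
      by (simp add: algebra_simps)
  qed
  have refl1: "(\<Sum>u = 1..N. \<Sum>v = 1..N. \<chi> (s - u) * g v * K (s - u - h v))
      = (\<Sum>u = 1..N. \<Sum>v = 1..N. \<chi> u * g v * K (u - h v))" for g h
  proof (rule sum_cyclic_reflect[OF _ N_pos])
    show "cyclic N (\<lambda>u. \<Sum>v = 1..N. \<chi> u * g v * K (u - h v))"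
    proof -
      have "K (u + N - h v) = K (u - h v)" for u v
        using K(1)[of "u - h v"] by (simp add: algebra_simps)
      then show ?thesis unfolding cyclic_def ch by simp
    qed
  qed
  have 2: "energy N K \<chi> = (\<Sum>u = 1..N. \<Sum>v = 1..N. \<chi> (s - u) * \<chi> v * K (u + v - s))"
  proof -
    have "K (s - u - v) = K (u + v - s)" for u v
      using K_even[of "u + v - s"] by (simp add: algebra_simps)
    then show ?thesis unfolding energy_def using refl1[of \<chi> "\<lambda>v. v"] by simp
  qed
  have 3: "energy N K \<chi> = (\<Sum>u = 1..N. \<Sum>v = 1..N. \<chi> (s - u) * \<chi> (s - v) * K (u - v))"
  proof -
    have "K (s - u - (s - v)) = K (u - v)" for u v
      using K_even[of "u - v"] by (simp add: algebra_simps)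
    moreover have "K (u - (s - v)) = K (u + v - s)" for u v by (simp add: algebra_simps)
    ultimately show ?thesis unfolding 1 using refl1[of "\<lambda>v. \<chi> (s - v)" "\<lambda>v. s - v"] by simp
  qed
  have "8 * energy N K \<chi> = 2 * energy N K \<chi> + 2 * energy N K \<chi> + 2 * energy N K \<chi> + 2 * energy N K \<chi>"
    by simp
  also have "\<dots> = 2 * (\<Sum>u = 1..N. \<Sum>v = 1..N. \<chi> u * \<chi> v * K (u - v))
      + 2 * (\<Sum>u = 1..N. \<Sum>v = 1..N. \<chi> u * \<chi> (s - v) * K (u + v - s))
      + 2 * (\<Sum>u = 1..N. \<Sum>v = 1..N. \<chi> (s - u) * \<chi> v * K (u + v - s))
      + 2 * (\<Sum>u = 1..N. \<Sum>v = 1..N. \<chi> (s - u) * \<chi> (s - v) * K (u - v))"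
    using 1 2 3 unfolding energy_def by argo
  also have "\<dots> = (\<Sum>u = 1..N. \<Sum>v = 1..N. 2 * (\<chi> u * \<chi> v * K (u - v))
      + 2 * (\<chi> u * \<chi> (s - v) * K (u + v - s)) + 2 * (\<chi> (s - u) * \<chi> v * K (u + v - s))
      + 2 * (\<chi> (s - u) * \<chi> (s - v) * K (u - v)))"
    by (simp only: sum.distrib sum_distrib_left)
  also have "\<dots> = (\<Sum>u = 1..N. \<Sum>v = 1..N.
     (\<chi> u + \<chi> (s - u)) * (\<chi> v + \<chi> (s - v)) * (K (u - v) + K (u + v - s))
   + (\<chi> u - \<chi> (s - u)) * (\<chi> v - \<chi> (s - v)) * (K (u - v) - K (u + v - s)))"
    by (intro sum.cong refl) (simp add: algebra_simps)
  finally show ?thesis .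
qed

text \<open>Two points on the same side of the axis are closer to each other than either is to the mirror image of the
other; for points on opposite sides it is the other way round.\<close>
lemma side_kernel_nonneg:
  "0 \<le> side N s u * side N s v * (K (u - v) - K (u + v - s))"
proof -
  obtain u' where u': "u' mod N = u mod N" "- N < 2 * u' - s" "2 * u' - s \<le> N"
    using centered_lift[OF N_pos] by blast
  obtain v' where v': "v' mod N = v mod N" "- N < 2 * v' - s" "2 * v' - s \<le> N"
    using centered_lift[OF N_pos] by blast
  have 1: "side N s u = side N s u'" "side N s v = side N s v'"
    using cyclic_cong[OF cyclic_side] u'(1) v'(1) by metis+
  have 2: "K (u - v) = K (u' - v')"
    using u'(1)[symmetric] v'(1)[symmetric] by (intro cyclic_cong[OF K_cyclic] mod_diff_cong)
  have 3: "K (u + v - s) = K (u' + v' - s)"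
    using u'(1)[symmetric] v'(1)[symmetric] by (intro cyclic_cong[OF K_cyclic] mod_diff_cong mod_add_cong refl)
  note s = side_centered[OF N_pos u'(2,3)] side_centered[OF N_pos v'(2,3)]
  show ?thesis
  proof (cases "side N s u' = 0 \<or> side N s v' = 0")
    case True then show ?thesis using 1 by auto
  next
    case False
    then have ne: "2 * u' \<noteq> s" "2 * u' \<noteq> s + N" "2 * v' \<noteq> s" "2 * v' \<noteq> s + N"
      using s by auto
    have "K (u' + v' - s) \<le> K (u' - v')" if "2 * u' < s \<longleftrightarrow> 2 * v' < s"
      using that ne u'(2,3) v'(2,3) by (intro K_antimono) (auto simp: abs_if)
    moreover have "K (u' - v') \<le> K (u' + v' - s)" if "\<not> (2 * u' < s \<longleftrightarrow> 2 * v' < s)"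
      using that ne u'(2,3) v'(2,3) by (intro K_antimono) (auto simp: abs_if)
    ultimately show ?thesis unfolding 1 2 3 s using ne by auto
  qed
qed

text \<open>In the symmetrized energy the product of the two differences is replaced by its absolute value, with the
sign that the kernel difference rewards.\<close>
lemma energy_polarize:
  assumes "cyclic N \<chi>"
  shows "energy N K \<chi> \<le> energy N K (polarize N s \<chi>)"
proof -
  have "8 * energy N K \<chi> \<le> 8 * energy N K (polarize N s \<chi>)"
    unfolding energy_symmetrized[OF assms, of s]
      energy_symmetrized[OF cyclic_polarize[OF assms], of s s]
      polarize_add[OF N_pos] polarize_diff[OF N_pos]
  proof (intro sum_mono add_left_mono)
    fix u v
    let ?q = "\<lambda>u. \<chi> u - \<chi> (s - u)" and ?D = "K (u - v) - K (u + v - s)"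
    let ?e = "side N s u * side N s v"
    show "?q u * ?q v * ?D \<le> side N s u * \<bar>?q u\<bar> * (side N s v * \<bar>?q v\<bar>) * ?D"
    proof (cases "?e = 0")
      case True
      then have "?q u = 0 \<or> ?q v = 0" using side_zero_fixed[OF N_pos _ assms] by auto
      then show ?thesis by auto
    next
      case False
      then have "\<bar>?e\<bar> = 1" using side_cases[of N s u] side_cases[of N s v] by (elim disjE) simp_all
      have "?q u * ?q v * ?D \<le> \<bar>?q u * ?q v * ?D\<bar>" by (rule abs_ge_self)
      also have "\<dots> = \<bar>?q u\<bar> * \<bar>?q v\<bar> * \<bar>?e * ?D\<bar>"
        using \<open>\<bar>?e\<bar> = 1\<close> by (simp only: abs_mult mult_1_left)
      also have "\<dots> = \<bar>?q u\<bar> * \<bar>?q v\<bar> * (?e * ?D)"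
        using side_kernel_nonneg[of s u v] by simp
      finally show ?thesis by (simp add: mult_ac)
    qed
  qed
  then show ?thesis by simp
qed

end

text \<open>The periodic indicator of \<open>{1..m}\<close>.\<close>
definition arc :: "int \<Rightarrow> int \<Rightarrow> int \<Rightarrow> real" where
  "arc N m u = of_bool ((u - 1) mod N < m)"

lemma mod_shift: "(u + N - 1) mod N = (u - 1) mod (N::int)"
proof -
  have "u + N - 1 = u - 1 + N" by simp
  then show ?thesis by (simp only: mod_add_self2)
qed

lemma cyclic_arc: "cyclic N (arc N m)"
  unfolding cyclic_def arc_def using mod_shift by simp

lemma arc_eq: "u \<in> {1..N} \<Longrightarrow> arc N m u = of_bool (u \<le> m)"
  by (auto simp: arc_def mod_pos_pos_trivial)

text \<open>An axis that exchanges a point of the arc with a point outside has the midpoint of the arc on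
the side of the former, so the arc is already polarized with respect to it.\<close>
lemma arc_polarized:
  assumes "1 \<le> x" "x \<le> m" "m < y" "y \<le> N"
  shows "0 \<le> side N (x + y) u * (arc N m u - arc N m (x + y - u))"
proof -
  define s where "s = x + y"
  have N: "N > 0" using assms by simp
  have *: "arc N m (s - v) \<le> arc N m v" if v: "- N < 2 * v - s" "2 * v < s" for v
  proof -
    have "arc N m v = 1" if "arc N m (s - v) = 1"
    proof -
      have t: "0 \<le> s - v - 1" "s - v - 1 < 2 * N"
        using v assms by (auto simp: s_def)
      have "1 \<le> v \<and> v \<le> m"
      proof (cases "s - v - 1 < N")
        case True
        then have "s - v - 1 < m"
          using that t by (simp add: arc_def mod_pos_pos_trivial split: if_splits)
        then show ?thesis using v assms by (auto simp: s_def)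
      next
        case False
        then have "(s - v - 1) mod N = s - v - 1 - N"
        proof -
          have "(s - v - 1) mod N = (s - v - 1 - N) mod N" by (simp only: minus_mod_self2)
          also have "\<dots> = s - v - 1 - N" using t False by (intro mod_pos_pos_trivial) auto
          finally show ?thesis .
        qed
        then have "s - v - 1 - N < m"
          using that by (simp add: arc_def split: if_splits)
        then show ?thesis using v assms False by (auto simp: s_def)
      qed
      then show ?thesis using assms by (subst arc_eq) auto
    qed
    then show ?thesis by (auto simp: arc_def)
  qed
  have main: "0 \<le> side N s v * (arc N m v - arc N m (s - v))" if v: "- N < 2 * v - s" "2 * v - s \<le> N" for v
  proof (cases "side N s v = 0")
    case False
    then show ?thesis
      using side_centered[OF N v] *[of v] *[of "s - v"] v by (auto split: if_splits)
  qed simp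
  obtain v where v: "v mod N = u mod N" "- N < 2 * v - s" "2 * v - s \<le> N"
    using centered_lift[OF N] by blast
  have "side N s u = side N s v" "arc N m u = arc N m v"
    using cyclic_cong[OF cyclic_side] cyclic_cong[OF cyclic_arc] v(1) by metis+
  moreover have "arc N m (s - u) = arc N m (s - v)"
    by (intro cyclic_cong[OF cyclic_arc] mod_diff_cong refl) (simp add: v(1))
  ultimately show ?thesis using main[OF v(2,3)] by (simp add: s_def)
qed


text \<open>Induction on the number of points of the arc that \<open>\<chi>\<close> misses. If \<open>\<chi>\<close> misses \<open>x\<close>, it contains some
\<open>y\<close> outside the arc. Polarizing in the axis that exchanges \<open>x\<close> and \<open>y\<close> moves \<open>y\<close> to \<open>x\<close>, and
no other mirror pair loses a point of the arc, because the arc itself is polarized in this axis.\<close>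
lemma (in cyclic_kernel) energy_le_arc:
  assumes "cyclic N \<chi>" "\<And>u. \<chi> u \<in> {0, 1}" "(\<Sum>u = 1..N. \<chi> u) = of_int m" "0 \<le> m" "m \<le> N"
  shows "energy N K \<chi> \<le> energy N K (arc N m)"
  using assms(1-3)
proof (induction "card {u \<in> {1..m}. \<chi> u = 0}" arbitrary: \<chi> rule: less_induct)
  case less
  have split: "(\<Sum>u = 1..N. g u) = (\<Sum>u = 1..m. g u) + (\<Sum>u = m + 1..N. g u)" for g :: "int \<Rightarrow> real"
  proof -
    have "{1..N} = {1..m} \<union> {m + 1..N}" using assms(4,5) by auto
    then show ?thesis by (simp add: sum.union_disjoint)
  qed
  have inside: "(\<Sum>u = 1..N. \<phi> u * arc N m u) = of_int m - of_nat (card {u \<in> {1..m}. \<phi> u = 0})"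
    if "\<And>u. \<phi> u \<in> {0, 1}" for \<phi> :: "int \<Rightarrow> real"
  proof -
    have "(\<Sum>u = 1..N. \<phi> u * arc N m u) = (\<Sum>u = 1..m. \<phi> u)"
    proof -
      have "(\<Sum>u = 1..m. \<phi> u * arc N m u) = (\<Sum>u = 1..m. \<phi> u)"
        using assms(5) by (intro sum.cong) (auto simp: arc_eq)
      moreover have "(\<Sum>u = m + 1..N. \<phi> u * arc N m u) = 0"
        using assms(4) by (intro sum.neutral) (auto simp: arc_eq)
      ultimately show ?thesis unfolding split by simp
    qed
    also have "\<dots> = (\<Sum>u = 1..m. 1 - of_bool (\<phi> u = 0))"
    proof (rule sum.cong[OF refl])
      fix u show "\<phi> u = 1 - of_bool (\<phi> u = 0)" using that[of u] by auto
    qed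
    also have "\<dots> = of_int m - of_nat (card {u \<in> {1..m}. \<phi> u = 0})"
      using assms(4) by (simp add: sum_subtractf Int_def)
    finally show ?thesis .
  qed
  show ?case
  proof (cases "\<exists>x\<in>{1..m}. \<chi> x = 0")
    case False
    then have one: "\<chi> u = 1" if "u \<in> {1..m}" for u using less.prems(2)[of u] that by auto
    then have "(\<Sum>u = m + 1..N. \<chi> u) = 0" using less.prems(3) assms(4) unfolding split by simp
    moreover have "0 \<le> \<chi> u" for u using less.prems(2)[of u] by auto
    ultimately have zero: "\<chi> u = 0" if "u \<in> {m + 1..N}" for u
      using that sum_nonneg_eq_0_iff[of "{m + 1..N}" \<chi>] by simp
    have "\<chi> u = arc N m u" if "u \<in> {1..N}" for u
      using that one[of u] zero[of u] by (auto simp: arc_eq)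
    then show ?thesis unfolding energy_def by (intro eq_refl sum.cong refl) simp
  next
    case True
    then obtain x where x: "x \<in> {1..m}" "\<chi> x = 0" by blast
    have "\<exists>y\<in>{m + 1..N}. \<chi> y = 1"
    proof (rule ccontr)
      assume "\<not> ?thesis"
      then have "\<chi> u = 0" if "u \<in> {m + 1..N}" for u using less.prems(2)[of u] that by auto
      then have "of_int m = (\<Sum>u = 1..m. \<chi> u)" using less.prems(3) unfolding split by simp
      also have "\<dots> < (\<Sum>u = 1..m. 1)"
      proof (rule sum_strict_mono_ex1)
        show "\<forall>u\<in>{1..m}. \<chi> u \<le> 1"
        proof
          fix u show "\<chi> u \<le> 1" using less.prems(2)[of u] by auto
        qed
        show "\<exists>u\<in>{1..m}. \<chi> u < 1" using x by (intro bexI[of _ x]) auto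
      qed simp
      finally show False using assms(4) by simp
    qed
    then obtain y where y: "y \<in> {m + 1..N}" "\<chi> y = 1" by blast
    define s where "s = x + y"
    let ?\<psi> = "polarize N s \<chi>"
    note \<psi> = cyclic_polarize[OF less.prems(1), of s] polarize_01[OF N_pos less.prems(1,2), of s]
    let ?d = "\<lambda>\<phi> u. \<phi> u - \<phi> (s - u) :: real"
    have pol: "0 \<le> side N s u * ?d (arc N m) u" for u
      using arc_polarized[of x m y N u] x y unfolding s_def by auto
    have arc_x: "?d (arc N m) x = 1" using x y by (simp add: s_def arc_eq)
    have le: "?d \<chi> u * ?d (arc N m) u \<le> ?d ?\<psi> u * ?d (arc N m) u" for u
    proof (cases "side N s u = 0")
      case True
      then show ?thesis using side_zero_fixed[OF N_pos True cyclic_arc] by simp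
    next
      case False
      then have "\<bar>side N s u\<bar> = 1" using side_cases[of N s u] by linarith
      have "?d \<chi> u * ?d (arc N m) u \<le> \<bar>?d \<chi> u\<bar> * \<bar>side N s u * ?d (arc N m) u\<bar>"
      proof -
        have "\<bar>side N s u * ?d (arc N m) u\<bar> = \<bar>?d (arc N m) u\<bar>"
          by (simp only: abs_mult \<open>\<bar>side N s u\<bar> = 1\<close> mult_1_left)
        then show ?thesis by (simp only: abs_mult[symmetric] abs_ge_self)
      qed
      also have "\<dots> = \<bar>?d \<chi> u\<bar> * (side N s u * ?d (arc N m) u)" using pol[of u] by simp
      finally show ?thesis unfolding polarize_diff[OF N_pos] by (simp add: mult_ac)
    qed
    have "?d \<chi> x * ?d (arc N m) x < ?d ?\<psi> x * ?d (arc N m) x"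
    proof -
      have "\<bar>side N s x\<bar> = 1"
      proof -
        have "side N s x \<noteq> 0" using side_zero_fixed[OF N_pos _ cyclic_arc, of s x m] arc_x by linarith
        then show ?thesis using side_cases[of N s x] by linarith
      qed
      then have "side N s x = 1" using pol[of x] unfolding arc_x by simp
      moreover have "?d \<chi> x = - 1" using x y by (simp add: s_def)
      ultimately show ?thesis unfolding polarize_diff[OF N_pos] arc_x by simp
    qed
    then have "(\<Sum>u = 1..N. (\<chi> u + \<chi> (s - u)) * (arc N m u + arc N m (s - u)) + ?d \<chi> u * ?d (arc N m) u)
        < (\<Sum>u = 1..N. (\<chi> u + \<chi> (s - u)) * (arc N m u + arc N m (s - u)) + ?d ?\<psi> u * ?d (arc N m) u)"
    proof (intro sum_strict_mono_ex1 ballI add_left_mono le)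
      assume strict: "?d \<chi> x * ?d (arc N m) x < ?d ?\<psi> x * ?d (arc N m) x"
      have "x \<in> {1..N}" using x(1) assms(5) by simp
      with add_strict_left_mono[OF strict]
      show "\<exists>u\<in>{1..N}. (\<chi> u + \<chi> (s - u)) * (arc N m u + arc N m (s - u)) + ?d \<chi> u * ?d (arc N m) u
          < (\<chi> u + \<chi> (s - u)) * (arc N m u + arc N m (s - u)) + ?d ?\<psi> u * ?d (arc N m) u"
        by (rule bexI)
    qed simp
    also have "\<dots> = 4 * (\<Sum>u = 1..N. ?\<psi> u * arc N m u)"
      unfolding sum_mult_symmetrized[OF N_pos \<psi>(1) cyclic_arc, where s = s] polarize_add[OF N_pos] ..
    finally have "(\<Sum>u = 1..N. \<chi> u * arc N m u) < (\<Sum>u = 1..N. ?\<psi> u * arc N m u)"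
      unfolding sum_mult_symmetrized[OF N_pos less.prems(1) cyclic_arc, where s = s, symmetric] by simp
    then have "card {u \<in> {1..m}. ?\<psi> u = 0} < card {u \<in> {1..m}. \<chi> u = 0}"
      unfolding inside[OF less.prems(2)] inside[OF \<psi>(2)] by simp
    then have "energy N K ?\<psi> \<le> energy N K (arc N m)"
    proof (rule less.hyps[OF _ \<psi>])
      show "(\<Sum>u = 1..N. ?\<psi> u) = of_int m"
        unfolding sum_polarize[OF N_pos less.prems(1)] by (rule less.prems(3))
    qed
    with energy_polarize[OF less.prems(1), of s] show ?thesis by (rule order.trans)
  qed
qed

lemma (in cyclic_kernel) sum_kernel_le_interval:
  assumes "S \<subseteq> {1..N}"
  shows "(\<Sum>u\<in>S. \<Sum>v\<in>S. K (u - v)) \<le> (\<Sum>u = 1..int (card S). \<Sum>v = 1..int (card S). K (u - v))"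
proof -
  define \<chi> :: "int \<Rightarrow> real" where "\<chi> u = of_bool ((u - 1) mod N + 1 \<in> S)" for u
  have energy: "energy N K \<phi> = (\<Sum>u\<in>T. \<Sum>v\<in>T. K (u - v))"
    if "\<And>u. u \<in> {1..N} \<Longrightarrow> \<phi> u = of_bool (u \<in> T)" "T \<subseteq> {1..N}" for \<phi> T
  proof -
    have "energy N K \<phi> = (\<Sum>u = 1..N. \<Sum>v = 1..N. of_bool (u \<in> T) * of_bool (v \<in> T) * K (u - v))"
      unfolding energy_def using that(1) by (intro sum.cong refl) simp
    also have "\<dots> = (\<Sum>u\<in>T. \<Sum>v = 1..N. of_bool (v \<in> T) * K (u - v))"
      using that(2) by (intro sum.mono_neutral_cong_right) auto
    also have "\<dots> = (\<Sum>u\<in>T. \<Sum>v\<in>T. K (u - v))"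
    proof (rule sum.cong[OF refl])
      fix u show "(\<Sum>v = 1..N. of_bool (v \<in> T) * K (u - v)) = (\<Sum>v\<in>T. K (u - v))"
        using that(2) by (intro sum.mono_neutral_cong_right) auto
    qed
    finally show ?thesis .
  qed
  have \<chi>: "\<chi> u = of_bool (u \<in> S)" if "u \<in> {1..N}" for u
    using that by (simp add: \<chi>_def mod_pos_pos_trivial)
  have card: "int (card S) \<le> N" using card_mono[OF _ assms] N_pos by simp
  have "energy N K \<chi> \<le> energy N K (arc N (int (card S)))"
  proof (rule energy_le_arc[OF _ _ _ _ card])
    show "cyclic N \<chi>"
      unfolding cyclic_def \<chi>_def using mod_shift by simp
    show "\<chi> u \<in> {0, 1}" for u by (simp add: \<chi>_def)
    have "(\<Sum>u = 1..N. \<chi> u) = (\<Sum>u\<in>S. 1)"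
      using assms \<chi> by (intro sum.mono_neutral_cong_right) auto
    then show "(\<Sum>u = 1..N. \<chi> u) = of_int (int (card S))" by simp
  qed simp
  moreover have "energy N K (arc N (int (card S))) = (\<Sum>u = 1..int (card S). \<Sum>v = 1..int (card S). K (u - v))"
    using card by (intro energy) (auto simp: arc_eq)
  ultimately show ?thesis using energy[OF \<chi> assms] by simp
qed

section \<open>Benevolent functions on sets of integers\<close>

lemma card_shift_pairs:
  fixes S :: "int set"
  shows "card {p \<in> S \<times> S. fst p - snd p = e} = card {v \<in> S. v + e \<in> S}"
proof -
  have "bij_betw (\<lambda>v. (v + e, v)) {v \<in> S. v + e \<in> S} {p \<in> S \<times> S. fst p - snd p = e}"
    by (rule bij_betwI[of _ _ _ snd]) auto
  then show ?thesis by (simp add: bij_betw_same_card)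
qed

text \<open>For \<open>e > N / 2\<close> the segments \<open>{1..N - e}\<close> and \<open>{e + 1..N}\<close> are disjoint, and only \<open>2 * e - N\<close> numbers
lie between them. Hence they contain at least \<open>card S - (2 * e - N)\<close> elements of \<open>S\<close>, and after
shifting the second segment onto the first, two subsets of a set of size \<open>N - e\<close> must overlap
in at least \<open>card S - e\<close> points.\<close>
lemma card_far_pairs_ge:
  fixes S :: "int set"
  assumes "S \<subseteq> {1..N}" "N < 2 * e" "e \<le> N"
  shows "int (card S) - e \<le> int (card {v \<in> S. v + e \<in> S})"
proof -
  have fin: "finite S" using assms(1) finite_subset by blast
  define A B where "A = {v \<in> S. v \<le> N - e}" and "B = {v. v + e \<in> S \<and> 1 \<le> v}"
  have B: "B = (\<lambda>v. v - e) ` {v \<in> S. e < v}"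
    by (force simp: B_def image_iff)
  have cB: "card B = card {v \<in> S. e < v}"
    unfolding B by (intro card_image inj_onI) simp
  have AB: "finite A" "finite B" "A \<subseteq> {1..N - e}" "B \<subseteq> {1..N - e}"
    using assms fin unfolding B by (auto simp: A_def)
  have "card S \<le> card (A \<union> ({v \<in> S. e < v} \<union> {N - e + 1..e}))"
    using fin by (intro card_mono) (auto simp: A_def)
  also have "\<dots> \<le> card A + (card {v \<in> S. e < v} + card {N - e + 1..e})"
    by (meson add_left_mono card_Un_le le_trans)
  finally have 1: "int (card S) \<le> int (card A) + int (card B) + (2 * e - N)"
    using assms(2) unfolding cB by simp
  have "card (A \<union> B) \<le> card {1..N - e}" using AB by (intro card_mono) auto
  then have 2: "int (card (A \<union> B)) \<le> N - e" using assms(3) by simp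
  have "A \<inter> B \<subseteq> {v \<in> S. v + e \<in> S}" by (auto simp: A_def B_def)
  then have 3: "card (A \<inter> B) \<le> card {v \<in> S. v + e \<in> S}" using fin by (intro card_mono) auto
  show ?thesis using 1 2 3 card_Un_Int[OF AB(1,2)] by linarith
qed

lemma card_interval_pairs:
  assumes "0 < e"
  shows "int (card {v \<in> {1..int m}. v + e \<in> {1..int m}}) = max 0 (int m - e)"
proof -
  have "{v \<in> {1..int m}. v + e \<in> {1..int m}} = {1..int m - e}" using assms by auto
  then show ?thesis by simp
qed

lemma card_neg_shift:
  fixes S :: "int set"
  shows "card {v \<in> S. v + (- e) \<in> S} = card {v \<in> S. v + e \<in> S}"
proof -
  have "bij_betw (\<lambda>v. v + e) {v \<in> S. v + e \<in> S} {v \<in> S. v + (- e) \<in> S}"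
    by (rule bij_betwI[of _ _ _ "\<lambda>v. v - e"]) auto
  then show ?thesis by (simp add: bij_betw_same_card)
qed

lemma sum_pairs_by_difference:
  fixes S :: "int set" and g :: "int \<Rightarrow> real"
  assumes "S \<subseteq> {1..N}"
  shows "(\<Sum>u\<in>S. \<Sum>v\<in>S. g (u - v)) =
    (\<Sum>e\<in>{- N<..<N}. g e * real (card {v \<in> S. v + e \<in> S}))"
proof -
  have fin: "finite S" using assms finite_subset by blast
  have "(\<Sum>u\<in>S. \<Sum>v\<in>S. g (u - v)) = (\<Sum>p\<in>S \<times> S. g (fst p - snd p))"
    by (simp add: sum.cartesian_product case_prod_beta)
  also have "\<dots> = (\<Sum>e\<in>{- N<..<N}. \<Sum>p | p \<in> S \<times> S \<and> fst p - snd p = e. g (fst p - snd p))"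
  proof (intro sum.group[symmetric])
    show "(\<lambda>p. fst p - snd p) ` (S \<times> S) \<subseteq> {- N<..<N}"
    proof
      fix e assume "e \<in> (\<lambda>p. fst p - snd p) ` (S \<times> S)"
      then obtain u v where "u \<in> S" "v \<in> S" "e = u - v" by auto
      then have "u \<in> {1..N}" "v \<in> {1..N}" "e = u - v" using assms by blast+
      then show "e \<in> {- N<..<N}" by simp
    qed
  qed (use fin in auto)
  also have "\<dots> = (\<Sum>e\<in>{- N<..<N}. g e * real (card {v \<in> S. v + e \<in> S}))"
    by (intro sum.cong refl) (simp add: mult.commute flip: card_shift_pairs)
  finally show ?thesis .
qed

lemma sum_far_pairs_ge_interval:
  fixes g :: "int \<Rightarrow> real"
  assumes S: "S \<subseteq> {1..N}"
    and near: "\<And>e. e \<noteq> 0 \<Longrightarrow> 2 * \<bar>e\<bar> \<le> N \<Longrightarrow> g e = 0"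
    and far: "\<And>e. N < 2 * \<bar>e\<bar> \<Longrightarrow> \<bar>e\<bar> < N \<Longrightarrow> 0 \<le> g e"
  shows "(\<Sum>u = 1..int (card S). \<Sum>v = 1..int (card S). g (u - v)) \<le> (\<Sum>u\<in>S. \<Sum>v\<in>S. g (u - v))"
proof -
  let ?I = "{1..int (card S)}"
  have fin: "finite S" using S finite_subset by blast
  have I: "?I \<subseteq> {1..N}"
  proof -
    have "card S \<le> nat N" using card_mono[OF _ S] by simp
    then show ?thesis by auto
  qed
  have "real (card {v \<in> ?I. v + e \<in> ?I}) * g e \<le> real (card {v \<in> S. v + e \<in> S}) * g e"
    if e: "e \<in> {- N<..<N}" for e
  proof -
    consider "e = 0" | "e \<noteq> 0" "2 * \<bar>e\<bar> \<le> N" | "N < 2 * \<bar>e\<bar>" by linarith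
    then show ?thesis
    proof cases
      case 1
      then have "{v \<in> X. v + e \<in> X} = X" for X by simp
      then show ?thesis by (simp only:) simp
    next
      case 2 then show ?thesis using near by simp
    next
      case 3
      have abs: "card {v \<in> X. v + e \<in> X} = card {v \<in> X. v + \<bar>e\<bar> \<in> X}" for X :: "int set"
        using card_neg_shift[of X e] by (simp add: abs_if)
      have "0 < \<bar>e\<bar>" using 3 e by auto
      then have "int (card {v \<in> ?I. v + \<bar>e\<bar> \<in> ?I}) \<le> int (card {v \<in> S. v + \<bar>e\<bar> \<in> S})"
        using card_far_pairs_ge[OF S 3] e card_interval_pairs[of "\<bar>e\<bar>" "card S"] by auto
      then show ?thesis
        unfolding abs using far[OF 3] e by (intro mult_right_mono) auto
    qed
  qed
  then show ?thesis
    unfolding sum_pairs_by_difference[OF S] sum_pairs_by_difference[OF I]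
    by (intro sum_mono) (simp add: mult.commute)
qed

text \<open>Replacing \<open>f d\<close> by \<open>f (N - d)\<close> for \<open>d > N / 2\<close> gives a cyclic kernel \<open>K\<close>, and the difference
\<open>K - f\<close> is non-negative and vanishes at all non-zero differences up to \<open>N / 2\<close>. An interval
maximizes the sum for \<open>K\<close> and minimizes the sum for \<open>K - f\<close>.\<close>
lemma benevolent_sum_le_interval:
  fixes f :: "int \<Rightarrow> real"
  assumes S: "S \<subseteq> {1..N}"
    and even: "\<And>z. \<bar>z\<bar> < N \<Longrightarrow> f (- z) = f z"
    and dec: "\<And>i. 1 \<le> i \<Longrightarrow> i + 1 \<le> N div 2 \<Longrightarrow> f (i + 1) \<le> f i"
    and fold: "\<And>i. 1 \<le> i \<Longrightarrow> i \<le> N div 2 \<Longrightarrow> f (N - i) \<le> f i"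
  shows "(\<Sum>u\<in>S. \<Sum>v\<in>S. f (u - v)) \<le> (\<Sum>u = 1..int (card S). \<Sum>v = 1..int (card S). f (u - v))"
proof (cases "N > 0")
  case False
  then have "S = {}" using S by auto
  then show ?thesis by simp
next
  case N: True
  \<comment> \<open>The value at \<open>0\<close> is chosen as the largest value elsewhere; it only adds a constant multiple of \<open>card S\<close>.\<close>
  define K where "K z = (if z mod N = 0 then f 1 else f (min (z mod N) (N - z mod N)))" for z
  have small: "K z = f (min \<bar>z\<bar> (N - \<bar>z\<bar>))" if "z \<noteq> 0" "\<bar>z\<bar> < N" for z
  proof (cases "z > 0")
    case True
    then have "z mod N = z" using that by (intro mod_pos_pos_trivial) auto
    then show ?thesis using True by (simp add: K_def)
  next
    case False
    have "z mod N = (z + N) mod N" by simp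
    also have "\<dots> = z + N" using False that by (intro mod_pos_pos_trivial) auto
    finally show ?thesis using False that by (simp add: K_def min.commute add.commute)
  qed
  have dec': "f b \<le> f a" if "1 \<le> a" "a \<le> b" "b \<le> N div 2" for a b
    using that(2,3)
  proof (induction b rule: int_ge_induct)
    case (step b)
    then show ?case using dec[of b] that(1) by simp
  qed simp
  interpret cyclic_kernel N K
  proof
    show "N > 0" by fact
    show "cyclic N K" by (simp add: cyclic_def K_def)
    show "K (- z) = K z" for z
    proof (cases "z mod N = 0")
      case True
      then have "(- z) mod N = 0" by (simp add: zmod_zminus1_eq_if)
      then show ?thesis using True by (simp add: K_def)
    next
      case False
      then have "(- z) mod N = N - z mod N" by (simp add: zmod_zminus1_eq_if)
      moreover have "z mod N < N" using N by simp
      ultimately show ?thesis using False by (simp add: K_def min.commute)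
    qed
    show "K b \<le> K a" if ab: "\<bar>a\<bar> \<le> \<bar>b\<bar>" "\<bar>a\<bar> + \<bar>b\<bar> \<le> N" for a b
    proof -
      define d where "d z = min (z mod N) (N - z mod N)" for z
      have d: "1 \<le> d z \<and> d z \<le> N div 2" if "z mod N \<noteq> 0" for z
      proof -
        have "1 \<le> min r (N - r) \<and> min r (N - r) \<le> N div 2" if "0 \<le> r" "r < N" "r \<noteq> 0" for r
          using that by auto
        then show ?thesis unfolding d_def using that N pos_mod_sign[OF N, of z] pos_mod_bound[OF N, of z]
          by blast
      qed
      show ?thesis
      proof (cases "a = 0")
        case True
        have "K b = (if b mod N = 0 then f 1 else f (d b))" by (simp add: K_def d_def)
        also have "\<dots> \<le> f 1" using d[of b] dec'[of 1 "d b"] by simp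
        finally show ?thesis using True by (simp add: K_def)
      next
        case False
        then have b: "b \<noteq> 0" "\<bar>b\<bar> < N" and a: "\<bar>a\<bar> < N" using ab by auto
        have "f (min \<bar>b\<bar> (N - \<bar>b\<bar>)) \<le> f (min \<bar>a\<bar> (N - \<bar>a\<bar>))"
        proof -
          have *: "min y (N - y) \<ge> min x (N - x) \<and> 1 \<le> min x (N - x) \<and> min y (N - y) \<le> N div 2"
            if "1 \<le> x" "x \<le> y" "x + y \<le> N" "y < N" for x y :: int
          proof (intro conjI)
            have x: "min x (N - x) = x" using that by (intro min_absorb1) linarith
            show "min x (N - x) \<le> min y (N - y)" "1 \<le> min x (N - x)"
              unfolding x using that by (auto intro: min.boundedI)
            show "min y (N - y) \<le> N div 2" by linarith
          qed
          have "1 \<le> \<bar>a\<bar>" using False by linarith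
          from *[OF this ab b(2)] show ?thesis by (intro dec') blast+
        qed
        then show ?thesis using small[OF b] small[OF False a] by simp
      qed
    qed
  qed
  define g where "g z = K z - f z" for z
  have f_abs: "f z = f \<bar>z\<bar>" if "\<bar>z\<bar> < N" for z
    using even[OF that] by (simp add: abs_if)
  have "(\<Sum>u = 1..int (card S). \<Sum>v = 1..int (card S). g (u - v)) \<le> (\<Sum>u\<in>S. \<Sum>v\<in>S. g (u - v))"
  proof (rule sum_far_pairs_ge_interval[OF S])
    show "g e = 0" if "e \<noteq> 0" "2 * \<bar>e\<bar> \<le> N" for e
    proof -
      have "\<bar>e\<bar> < N" using that N by auto
      moreover have "min \<bar>e\<bar> (N - \<bar>e\<bar>) = \<bar>e\<bar>" using that by linarith
      ultimately show ?thesis unfolding g_def using small[OF that(1)] f_abs[of e] by simp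
    qed
    show "0 \<le> g e" if e: "N < 2 * \<bar>e\<bar>" "\<bar>e\<bar> < N" for e
    proof -
      have "e \<noteq> 0" using e N by auto
      moreover have "f \<bar>e\<bar> \<le> f (N - \<bar>e\<bar>)"
      proof -
        have "1 \<le> N - \<bar>e\<bar>" "N - \<bar>e\<bar> \<le> N div 2" using e by linarith+
        from fold[OF this] show ?thesis by simp
      qed
      moreover have "min \<bar>e\<bar> (N - \<bar>e\<bar>) = N - \<bar>e\<bar>" using e by linarith
      ultimately show ?thesis unfolding g_def using small[OF _ e(2)] f_abs[OF e(2)] by simp
    qed
  qed
  moreover note sum_kernel_le_interval[OF S]
  moreover have split: "(\<Sum>u\<in>T. \<Sum>v\<in>T. f (u - v)) = (\<Sum>u\<in>T. \<Sum>v\<in>T. K (u - v)) - (\<Sum>u\<in>T. \<Sum>v\<in>T. g (u - v))" for T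
    unfolding g_def sum_subtractf by simp
  ultimately show ?thesis unfolding split by linarith
qed

section \<open>From quadratic assignment to block weights\<close>

lemma ordered_partition_interval:
  assumes I: "ordered_partition n q I" and k: "k \<in> {1..q}"
  obtains a where "I k = {a + 1..a + card (I k)}"
proof (cases "I k = {}")
  case True
  then have "I k = {0 + 1..0 + card (I k)}" by simp
  then show ?thesis by (rule that)
next
  case False
  have sub: "I k \<subseteq> {1..n}" by (rule ordered_partition_subset[OF assms])
  have fin: "finite (I k)" using sub finite_subset by blast
  have convex: "z \<in> I k" if xyz: "x \<in> I k" "y \<in> I k" "x \<le> z" "z \<le> y" for x y z
  proof -
    have "x \<in> {1..n}" "y \<in> {1..n}" using xyz sub by blast+
    then have "z \<in> {1..n}" using xyz by simp
    then obtain l where l: "l \<in> {1..q}" "z \<in> I l"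
      using I unfolding ordered_partition_def by blast
    have "\<not> l < k" "\<not> k < l"
      using I k l xyz unfolding ordered_partition_def by (metis not_le)+
    then show ?thesis using l(2) by simp
  qed
  have eq: "I k = {Min (I k)..Max (I k)}"
    using False fin by (auto intro!: convex[OF Min_in Max_in])
  have "1 \<le> Min (I k)" using Min_in[OF fin False] sub by auto
  moreover have "Min (I k) \<le> Max (I k)" using fin False by simp
  moreover have "card (I k) = Suc (Max (I k)) - Min (I k)" by (subst eq) simp
  ultimately have "I k = {Min (I k) - 1 + 1..Min (I k) - 1 + card (I k)}" using eq by simp
  then show ?thesis by (rule that)
qed

lemma block_weight_toeplitz:
  assumes "toeplitz_of n f T" "S \<subseteq> {1..n}"
  shows "block_weight T S = (\<Sum>u\<in>int ` S. \<Sum>v\<in>int ` S. f (u - v))"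
  using assms unfolding block_weight_def toeplitz_of_def
  by (auto simp: sum.reindex intro!: sum.cong)

lemma sum_difference_translate:
  fixes f :: "int \<Rightarrow> real"
  shows "(\<Sum>u = c + 1..c + m. \<Sum>v = c + 1..c + m. f (u - v)) = (\<Sum>u = 1..m. \<Sum>v = 1..m. f (u - v))"
proof -
  have shift: "(\<Sum>u = c + 1..c + m. g u) = (\<Sum>u = 1..m. g (c + u))" for g :: "int \<Rightarrow> real"
    by (rule sum.reindex_bij_witness[of _ "\<lambda>u. c + u" "\<lambda>u. u - c"]) auto
  show ?thesis unfolding shift by simp
qed

lemma down_benevolent_consecutive_optimal:
  assumes T: "down_benevolent_toeplitz n T"
    and S: "S \<subseteq> {1..n}" and sub: "{a + 1..a + card S} \<subseteq> {1..n}"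
  shows "block_weight T S \<le> block_weight T {a + 1..a + card S}"
proof -
  obtain f where f: "toeplitz_of n f T" "symmetric_matrix n T"
    and dec: "\<And>i. 1 \<le> i \<Longrightarrow> i + 1 \<le> \<lceil>(real n - 1) / 2\<rceil> \<Longrightarrow> f (i + 1) \<le> f i"
    and fold: "\<And>i. 1 \<le> i \<Longrightarrow> i \<le> \<lceil>(real n - 1) / 2\<rceil> \<Longrightarrow> f (int n - i) \<le> f i"
    using T unfolding down_benevolent_toeplitz_def by blast
  have half: "\<lceil>(real n - 1) / 2\<rceil> = int n div 2"
  proof (cases "even n")
    case True
    then obtain m where "n = 2 * m" by (rule evenE)
    then show ?thesis by (intro ceiling_unique) auto
  next
    case False
    then obtain m where "n = 2 * m + 1" by (rule oddE)
    then show ?thesis by (intro ceiling_unique) auto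
  qed
  have even: "f (- z) = f z" if z: "\<bar>z\<bar> < int n" for z
  proof -
    have pos: "f (- int d) = f (int d)" if "d < n" for d
    proof -
      have "T (1 + d) 1 = T 1 (1 + d)"
        using f(2) that unfolding symmetric_matrix_def by auto
      then show ?thesis using f(1) that unfolding toeplitz_of_def by auto
    qed
    show ?thesis
    proof (cases "0 \<le> z")
      case True then show ?thesis using pos[of "nat z"] z by simp
    next
      case False then show ?thesis using pos[of "nat (- z)"] z by simp
    qed
  qed
  have "block_weight T S = (\<Sum>u\<in>int ` S. \<Sum>v\<in>int ` S. f (u - v))"
    by (rule block_weight_toeplitz[OF f(1) S])
  also have "\<dots> \<le> (\<Sum>u = 1..int (card (int ` S)). \<Sum>v = 1..int (card (int ` S)). f (u - v))"
  proof (rule benevolent_sum_le_interval[of _ "int n"])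
    show "int ` S \<subseteq> {1..int n}" using S by auto
  qed (use even dec fold half in auto)
  also have "\<dots> = (\<Sum>u = int a + 1..int a + int (card S). \<Sum>v = int a + 1..int a + int (card S). f (u - v))"
    by (simp add: sum_difference_translate card_image)
  also have "\<dots> = block_weight T {a + 1..a + card S}"
    unfolding block_weight_toeplitz[OF f(1) sub] by (simp add: image_int_atLeastAtMost add.commute)
  finally show ?thesis .
qed

lemma cut_matrix_eq:
  assumes C: "cut_matrix_of n q I C" and ij: "i \<in> {1..n}" "j \<in> {1..n}"
  shows "C i j = 1 - (\<Sum>k = 1..q. of_bool (i \<in> I k \<and> j \<in> I k))"
proof -
  have disj: "k = l" if "k \<in> {1..q}" "l \<in> {1..q}" "i \<in> I k" "i \<in> I l" for k l
    using C that unfolding cut_matrix_of_def ordered_partition_def disjoint_family_on_def by blast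
  show ?thesis
  proof (cases "\<exists>k\<in>{1..q}. i \<in> I k \<and> j \<in> I k")
    case True
    then obtain k where k: "k \<in> {1..q}" "i \<in> I k" "j \<in> I k" by blast
    have "(\<Sum>l = 1..q. of_bool (i \<in> I l \<and> j \<in> I l) :: real) = (\<Sum>l = 1..q. if l = k then 1 else 0)"
      using disj k by (intro sum.cong) auto
    also have "\<dots> = 1" using k(1) by simp
    finally show ?thesis using C ij True unfolding cut_matrix_of_def by simp
  next
    case False
    then have "(\<Sum>l = 1..q. of_bool (i \<in> I l \<and> j \<in> I l) :: real) = 0"
      by (intro sum.neutral) auto
    then show ?thesis using C ij False unfolding cut_matrix_of_def by simp
  qed
qed

lemma qap_value_cut_matrix:
  assumes C: "cut_matrix_of n q I C" and \<pi>: "\<pi> permutes {1..n}"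
  shows "qap_value n C B \<pi> =
    (\<Sum>i = 1..n. \<Sum>j = 1..n. B i j) - (\<Sum>k = 1..q. block_weight B (\<pi> -` I k))"
proof -
  have sub: "\<pi> -` I k \<subseteq> {1..n}" if "k \<in> {1..q}" for k
    using ordered_partition_subset[of n q I k] C that permutes_in_image[OF \<pi>]
    unfolding cut_matrix_of_def by blast
  have weight: "block_weight B (\<pi> -` I k) =
      (\<Sum>i = 1..n. \<Sum>j = 1..n. of_bool (\<pi> i \<in> I k \<and> \<pi> j \<in> I k) * B i j)" if k: "k \<in> {1..q}" for k
  proof -
    have "(\<Sum>i = 1..n. \<Sum>j = 1..n. of_bool (\<pi> i \<in> I k \<and> \<pi> j \<in> I k) * B i j)
        = (\<Sum>i\<in>\<pi> -` I k. \<Sum>j = 1..n. of_bool (\<pi> j \<in> I k) * B i j)"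
      using sub[OF k] by (intro sum.mono_neutral_cong_right) auto
    also have "\<dots> = (\<Sum>i\<in>\<pi> -` I k. \<Sum>j\<in>\<pi> -` I k. B i j)"
    proof (rule sum.cong[OF refl])
      fix i show "(\<Sum>j = 1..n. of_bool (\<pi> j \<in> I k) * B i j) = (\<Sum>j\<in>\<pi> -` I k. B i j)"
        using sub[OF k] by (intro sum.mono_neutral_cong_right) auto
    qed
    finally show ?thesis unfolding block_weight_def ..
  qed
  have "(\<Sum>k = 1..q. block_weight B (\<pi> -` I k))
      = (\<Sum>k = 1..q. \<Sum>i = 1..n. \<Sum>j = 1..n. of_bool (\<pi> i \<in> I k \<and> \<pi> j \<in> I k) * B i j)"
    using weight by (intro sum.cong) auto
  also have "\<dots> = (\<Sum>i = 1..n. \<Sum>k = 1..q. \<Sum>j = 1..n. of_bool (\<pi> i \<in> I k \<and> \<pi> j \<in> I k) * B i j)"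
    by (rule sum.swap)
  also have "\<dots> = (\<Sum>i = 1..n. \<Sum>j = 1..n. \<Sum>k = 1..q. of_bool (\<pi> i \<in> I k \<and> \<pi> j \<in> I k) * B i j)"
    by (intro sum.cong refl sum.swap)
  also have "\<dots> = (\<Sum>i = 1..n. \<Sum>j = 1..n. B i j - C (\<pi> i) (\<pi> j) * B i j)"
  proof (intro sum.cong[OF refl])
    fix i j assume "i \<in> {1..n}" "j \<in> {1..n}"
    then have "\<pi> i \<in> {1..n}" "\<pi> j \<in> {1..n}" using permutes_in_image[OF \<pi>] by blast+
    then have "C (\<pi> i) (\<pi> j) = 1 - (\<Sum>k = 1..q. of_bool (\<pi> i \<in> I k \<and> \<pi> j \<in> I k))"
      by (rule cut_matrix_eq[OF C])
    then show "(\<Sum>k = 1..q. of_bool (\<pi> i \<in> I k \<and> \<pi> j \<in> I k) * B i j)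
        = B i j - C (\<pi> i) (\<pi> j) * B i j"
      by (simp add: left_diff_distrib flip: sum_distrib_right)
  qed
  finally show ?thesis unfolding qap_value_def by (simp add: sum_subtractf)
qed

lemma qap_optimal_conic_left:
  assumes A: "conic_combination n Cs A"
    and opt: "\<And>C. C \<in> set Cs \<Longrightarrow> qap_optimal n C B id"
  shows "qap_optimal n A B id"
proof -
  obtain c where c: "\<And>k. k < length Cs \<Longrightarrow> 0 \<le> c k"
    "\<And>i j. i \<in> {1..n} \<Longrightarrow> j \<in> {1..n} \<Longrightarrow> A i j = (\<Sum>k < length Cs. c k * (Cs ! k) i j)"
    using A unfolding conic_combination_def by blast
  have lin: "qap_value n A B \<pi> = (\<Sum>k < length Cs. c k * qap_value n (Cs ! k) B \<pi>)"
    if "\<pi> permutes {1..n}" for \<pi>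
  proof -
    have "qap_value n A B \<pi> = (\<Sum>i = 1..n. \<Sum>j = 1..n. \<Sum>k < length Cs. c k * ((Cs ! k) (\<pi> i) (\<pi> j) * B i j))"
      unfolding qap_value_def
    proof (intro sum.cong[OF refl])
      fix i j assume "i \<in> {1..n}" "j \<in> {1..n}"
      then have "\<pi> i \<in> {1..n}" "\<pi> j \<in> {1..n}" using permutes_in_image[OF that] by blast+
      then show "A (\<pi> i) (\<pi> j) * B i j = (\<Sum>k < length Cs. c k * ((Cs ! k) (\<pi> i) (\<pi> j) * B i j))"
        by (simp add: c(2) sum_distrib_right mult.assoc)
    qed
    also have "\<dots> = (\<Sum>i = 1..n. \<Sum>k < length Cs. \<Sum>j = 1..n. c k * ((Cs ! k) (\<pi> i) (\<pi> j) * B i j))"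
      by (intro sum.cong refl sum.swap)
    also have "\<dots> = (\<Sum>k < length Cs. \<Sum>i = 1..n. \<Sum>j = 1..n. c k * ((Cs ! k) (\<pi> i) (\<pi> j) * B i j))"
      by (rule sum.swap)
    finally show ?thesis unfolding qap_value_def by (simp add: sum_distrib_left)
  qed
  show ?thesis
    unfolding qap_optimal_def
  proof (intro conjI allI impI)
    fix \<sigma> assume \<sigma>: "\<sigma> permutes {1..n}"
    show "qap_value n A B id \<le> qap_value n A B \<sigma>"
      unfolding lin[OF permutes_id] lin[OF \<sigma>]
      using c(1) opt \<sigma> unfolding qap_optimal_def by (intro sum_mono mult_left_mono) auto
  qed (rule permutes_id)
qed

lemma qap_optimal_conic_right:
  assumes B: "conic_combination n Bs B"
    and opt: "\<And>M. M \<in> set Bs \<Longrightarrow> qap_optimal n A M id"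
  shows "qap_optimal n A B id"
proof -
  obtain c where c: "\<And>k. k < length Bs \<Longrightarrow> 0 \<le> c k"
    "\<And>i j. i \<in> {1..n} \<Longrightarrow> j \<in> {1..n} \<Longrightarrow> B i j = (\<Sum>k < length Bs. c k * (Bs ! k) i j)"
    using B unfolding conic_combination_def by blast
  have lin: "qap_value n A B \<pi> = (\<Sum>k < length Bs. c k * qap_value n A (Bs ! k) \<pi>)" for \<pi>
  proof -
    have "qap_value n A B \<pi> = (\<Sum>i = 1..n. \<Sum>j = 1..n. \<Sum>k < length Bs. c k * (A (\<pi> i) (\<pi> j) * (Bs ! k) i j))"
      unfolding qap_value_def
      by (intro sum.cong[OF refl]) (simp add: c(2) sum_distrib_left mult.left_commute)
    also have "\<dots> = (\<Sum>i = 1..n. \<Sum>k < length Bs. \<Sum>j = 1..n. c k * (A (\<pi> i) (\<pi> j) * (Bs ! k) i j))"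
      by (intro sum.cong refl sum.swap)
    also have "\<dots> = (\<Sum>k < length Bs. \<Sum>i = 1..n. \<Sum>j = 1..n. c k * (A (\<pi> i) (\<pi> j) * (Bs ! k) i j))"
      by (rule sum.swap)
    finally show ?thesis unfolding qap_value_def by (simp add: sum_distrib_left)
  qed
  show ?thesis
    unfolding qap_optimal_def
  proof (intro conjI allI impI)
    fix \<sigma> assume \<sigma>: "\<sigma> permutes {1..n}"
    show "qap_value n A B id \<le> qap_value n A B \<sigma>"
      unfolding lin
      using c(1) opt \<sigma> unfolding qap_optimal_def by (intro sum_mono mult_left_mono) auto
  qed (rule permutes_id)
qed

text \<open>The preimages of the blocks under a permutation are an arbitrary partition with the same block sizes, which
is all that the maximality hypothesis refers to; this form serves both kinds of \<open>B\<close>.\<close>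
lemma qap_optimal_CDW_cut_matrix:
  assumes C: "CDW_cut_matrix n C"
    and max: "\<And>q I S. ordered_partition n q I \<Longrightarrow>
      (\<And>k l. 1 \<le> k \<Longrightarrow> k \<le> l \<Longrightarrow> l \<le> q \<Longrightarrow> card (I k) \<le> card (I l)) \<Longrightarrow>
      disjoint_family_on S {1..q} \<Longrightarrow> (\<Union>k\<in>{1..q}. S k) = {1..n} \<Longrightarrow>
      (\<And>k. k \<in> {1..q} \<Longrightarrow> card (S k) = card (I k)) \<Longrightarrow>
      (\<Sum>k = 1..q. block_weight B (S k)) \<le> (\<Sum>k = 1..q. block_weight B (I k))"
  shows "qap_optimal n C B id"
  unfolding qap_optimal_def
proof (intro conjI allI impI)
  fix \<sigma> assume \<sigma>: "\<sigma> permutes {1..n}"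
  obtain q I where I: "cut_matrix_of n q I C"
    and adjacent: "\<And>k. 1 \<le> k \<Longrightarrow> k + 1 \<le> q \<Longrightarrow> card (I k) \<le> card (I (k + 1))"
    using C unfolding CDW_cut_matrix_def by blast
  have part: "ordered_partition n q I" using I unfolding cut_matrix_of_def by blast
  have mono: "card (I k) \<le> card (I l)" if "1 \<le> k" "k \<le> l" "l \<le> q" for k l
    using that(2,3)
  proof (induction l rule: dec_induct)
    case (step l)
    then show ?case using \<open>1 \<le> k\<close> adjacent[of l] by simp
  qed simp
  have "(\<Sum>k = 1..q. block_weight B (\<sigma> -` I k)) \<le> (\<Sum>k = 1..q. block_weight B (I k))"
  proof (rule max[OF part mono])
    show "disjoint_family_on (\<lambda>k. \<sigma> -` I k) {1..q}"
      using part unfolding ordered_partition_def disjoint_family_on_def by blast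
    have "(\<Union>k\<in>{1..q}. \<sigma> -` I k) = \<sigma> -` {1..n}"
      using part unfolding ordered_partition_def by blast
    then show "(\<Union>k\<in>{1..q}. \<sigma> -` I k) = {1..n}"
      using permutes_vimage[OF \<sigma>] by simp
    show "card (\<sigma> -` I k) = card (I k)" for k
      using permutes_inj[OF \<sigma>] permutes_surj[OF \<sigma>] by (intro card_vimage_inj) auto
  qed
  then show "qap_value n C B id \<le> qap_value n C B \<sigma>"
    unfolding qap_value_cut_matrix[OF I permutes_id] qap_value_cut_matrix[OF I \<sigma>] by simp
qed (rule permutes_id)

theorem mainTheorem3:
  fixes n :: nat and A B M T :: real_matrix and Cs :: "real_matrix list"
  assumes "\<And>C. C \<in> set Cs \<Longrightarrow> CDW_cut_matrix n C"
    and "conic_combination n Cs A"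
    and "monotone_matrix n M" and "anti_Monge n M"
    and "down_benevolent_toeplitz n T"
    and "conic_combination n [M, T] B"
  shows "qap_optimal n A B id"
proof (rule qap_optimal_conic_left[OF assms(2)], rule qap_optimal_conic_right[OF assms(6)])
  fix C X assume C: "C \<in> set Cs" and X: "X \<in> set [M, T]"
  show "qap_optimal n C X id"
  proof (cases "X = M")
    case True
    show ?thesis unfolding True
      by (rule qap_optimal_CDW_cut_matrix[OF assms(1)[OF C]])
        (rule anti_Monge_consecutive_optimal[OF assms(3,4)])
  next
    case False
    then have [simp]: "X = T" using X by simp
    show ?thesis
    proof (rule qap_optimal_CDW_cut_matrix[OF assms(1)[OF C]])
      fix q I S
      assume I: "ordered_partition n q I" and S: "(\<Union>k\<in>{1..q}. S k) = {1..n}"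
        and card: "\<And>k. k \<in> {1..q} \<Longrightarrow> card (S k) = card (I k)"
      show "(\<Sum>k = 1..q. block_weight X (S k)) \<le> (\<Sum>k = 1..q. block_weight X (I k))"
      proof (rule sum_mono)
        fix k assume k: "k \<in> {1..q}"
        obtain a where a: "I k = {a + 1..a + card (S k)}"
          using ordered_partition_interval[OF I k] card[OF k] by metis
        have "S k \<subseteq> {1..n}" using S k by blast
        moreover have "{a + 1..a + card (S k)} \<subseteq> {1..n}"
          using ordered_partition_subset[OF I k] a by simp
        ultimately show "block_weight X (S k) \<le> block_weight X (I k)"
          unfolding a \<open>X = T\<close> by (rule down_benevolent_consecutive_optimal[OF assms(5)])
      qed
    qed
  qed
qed

end
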